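(* Let $\tau:A\to A^+$ be a one-to-one primitive substitution of constant length $p\ge 2$ such that $X_\tau$ is not finite. Let $\{x,y\}\subseteq X_\tau$ be a pair such that $\pi(x)=\pi(y)$, and let $\mathcal I=\mathcal I^+(x)=\mathcal I^+(y)$ and $k=k^+(x)=k^+(y)$. Then: (1) $(x,y)\in\mathbf A(X_\tau,T)$ if and only if either $\mathcal I$ is infinite and $s_i(x)=s_i(y)$ for all sufficiently large $i$, or $\mathcal I$ is finite and $s_i(T^k(x))=s_i(T^k(y))$ for all sufficiently large $i$. (2) Assume that $\tau$ has no coincidences. If there exists $i\in\mathbb Z$ such that $x_i\ne y_i$ and $|\mathcal I^+(T^i(x))|=\infty$, then $\{x,y\}$ is a distal pair. Otherwise the pair is asymptotic. In any case $\mathbf{LY}(X_\tau,T)=\emptyset$.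
   Context: $\mathbb N$ is the set of non-negative integers. A substitution is a map $\tau:A\to A^+$, where $A$ is a finite set and $A^+$ is the set of non-empty finite words over $A$; it is extended to $A^+$ and $A^{\mathbb Z}$ by concatenation (on $A^{\mathbb Z}$, $\tau(x)=\dots\tau(x_{-1}).\tau(x_0)\tau(x_1)\dots$, the dot preceding coordinate $0$). It has constant length $p$ if $|\tau(a)|=p$ for all $a\in A$, is one-to-one if $\tau(a)\neq\tau(b)$ for $a\ne b$ in $A$, and is primitive if there is $n$ such that $a$ appears in $\tau^n(b)$ for all $a,b\in A$. The shift is $T((x_i)_i)=(x_{i+1})_i$. $X_\tau$ is the smallest subshift (closed shift-invariant subset) of $A^{\mathbb Z}$ in which all words $\tau^n(a)$, $n\in\mathbb N$, $a\in A$, appear; fix a metric $\varrho$ compatible with its topology. Pairs: $\{x,y\}$ is distal if $\liminf_{n\to\infty}\varrho(T^nx,T^ny)>0$, proximal if this $\liminf$ is $0$, asymptotic if $\lim_{n\to\infty}\varrho(T^nx,T^ny)=0$, and Li–Yorke if it is proximal but not asymptotic. $\mathbf A(X_\tau,T)$ and $\mathbf{LY}(X_\tau,T)$ are the sets of asymptotic and Li–Yorke pairs. Coincidences: two words $u,u'$ of the same length have a coincidence if $u_i=u'_i$ for some coordinate $i$. $\tau$ has a coincidence if there are $a\ne b$ in $A$ such that $\tau(a)$ and $\tau(b)$ have a coincidence; otherwise it has no coincidences. Expansion: by known results (Dekking, Mossé), when $X_\tau$ is infinite, $\tau:X_\tau\to\tau(X_\tau)$ is injective and $\{T^i(\tau(X_\tau)):0\le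 i\le p-1\}$ is a clopen partition of $X_\tau$. Hence for each $x\in X_\tau$ there are a unique sequence $(x^{(i)})_{i\in\mathbb N}$ in $X_\tau$ and a unique sequence $(\delta_i)_{i\in\mathbb N}$ in $\{0,\dots,p-1\}$ with $x^{(0)}=x$ and $x^{(i)}=T^{\delta_i}\tau(x^{(i+1)})$ for all $i\ge 0$. Put $\pi(x)=(\delta_i)_{i\in\mathbb N}$. Put $s_i(x)=x^{(i)}_1x^{(i)}_2\cdots x^{(i)}_{p-1-\delta_i}$ (the empty word if $\delta_i=p-1$), and $\mathcal I^+(x)=\{i\in\mathbb N:|s_i(x)|\ne0\}$. Put $k^+(x)=\sup\{|x_0s_0(x)\tau(s_1(x))\cdots\tau^i(s_i(x))|:i\in\mathcal I^+(x)\}$, with $k^+(x)=|x_0|=1$ if $\mathcal I^+(x)=\emptyset$; it is finite exactly when $\mathcal I^+(x)$ is finite. $\mathcal I^+$ and $k^+$ depend only on $\pi(x)$. *)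

theory Defs
  imports "HOL-Analysis.Analysis"
begin

text \<open>The alphabet is a finite type \<open>'a\<close>; points of $A^{\mathbb Z}$ are functions on \<^typ>\<open>int\<close>.\<close>

type_synonym 'a config = "int \<Rightarrow> 'a"

section \<open>Substitutions\<close>

definition substitution :: "('a \<Rightarrow> 'a list) \<Rightarrow> bool" where
  "substitution \<tau> \<longleftrightarrow> (\<forall>a. \<tau> a \<noteq> [])"

definition constant_length :: "nat \<Rightarrow> ('a \<Rightarrow> 'a list) \<Rightarrow> bool" where
  "constant_length p \<tau> \<longleftrightarrow> (\<forall>a. length (\<tau> a) = p)"

definition subst_word :: "('a \<Rightarrow> 'a list) \<Rightarrow> 'a list \<Rightarrow> 'a list" where
  "subst_word \<tau> w = concat (map \<tau> w)"

definition primitive :: "('a \<Rightarrow> 'a list) \<Rightarrow> bool" where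
  "primitive \<tau> \<longleftrightarrow> (\<exists>n. \<forall>a b. a \<in> set ((subst_word \<tau> ^^ n) [b]))"

text \<open>
  The bi-infinite concatenation \<open>... \<tau>(x\<^bsub>-1\<^esub>) . \<tau>(x\<^sub>0) \<tau>(x\<^sub>1) ...\<close>. As the words \<open>\<tau> a\<close> are
  non-empty, coordinate \<open>j \<ge> 0\<close> lies inside \<open>\<tau>(x\<^sub>0 ... x\<^sub>j)\<close>, and coordinate \<open>j < 0\<close> is the
  letter at distance \<open>- j\<close> from the right end of \<open>\<tau>(x\<^sub>j ... x\<^bsub>-1\<^esub>)\<close>.
\<close>
definition subst_config :: "('a \<Rightarrow> 'a list) \<Rightarrow> 'a config \<Rightarrow> 'a config" where
  "subst_config \<tau> x j =
     (if 0 \<le> j then subst_word \<tau> (map x [0..j]) ! nat j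
      else let w = subst_word \<tau> (map x [j..-1]) in w ! nat (int (length w) + j))"

definition words_coincide :: "'a list \<Rightarrow> 'a list \<Rightarrow> bool" where
  "words_coincide u u' \<longleftrightarrow> length u = length u' \<and> (\<exists>i<length u. u ! i = u' ! i)"

definition has_coincidence :: "('a \<Rightarrow> 'a list) \<Rightarrow> bool" where
  "has_coincidence \<tau> \<longleftrightarrow> (\<exists>a b. a \<noteq> b \<and> words_coincide (\<tau> a) (\<tau> b))"

section \<open>The substitution subshift\<close>

text \<open>\<open>shift n\<close> is the power $T^n$ of the shift map $T$, for \<open>n :: int\<close>.\<close>

definition shift :: "int \<Rightarrow> 'a config \<Rightarrow> 'a config" where
  "shift n x = (\<lambda>i. x (i + n))"

definition config_topology :: "'a config topology" where
  "config_topology = product_topology (\<lambda>_. discrete_topology UNIV) UNIV"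

definition subshift :: "'a config set \<Rightarrow> bool" where
  "subshift Y \<longleftrightarrow> closedin config_topology Y \<and> shift 1 ` Y = Y"

definition appears_in :: "'a list \<Rightarrow> 'a config \<Rightarrow> bool" where
  "appears_in w x \<longleftrightarrow> (\<exists>i. \<forall>j<length w. x (i + int j) = w ! j)"

definition subst_shift :: "('a \<Rightarrow> 'a list) \<Rightarrow> 'a config set" where
  "subst_shift \<tau> = \<Inter>{Y. subshift Y \<and> (\<forall>n a. \<exists>x\<in>Y. appears_in ((subst_word \<tau> ^^ n) [a]) x)}"

text \<open>\<open>\<rho>\<close> is a metric on \<open>X\<close> inducing the topology of \<open>X\<close> as a subspace of $A^{\mathbb Z}$.\<close>

definition compatible_metric :: "'a config set \<Rightarrow> ('a config \<Rightarrow> 'a config \<Rightarrow> real) \<Rightarrow> bool" where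
  "compatible_metric X \<rho> \<longleftrightarrow>
     Metric_space X \<rho> \<and> Metric_space.mtopology X \<rho> = subtopology config_topology X"

section \<open>Distal, asymptotic and Li--Yorke pairs\<close>

text \<open>The lower limits are taken in the extended reals, so that they always exist.\<close>

definition distal_pair :: "('a config \<Rightarrow> 'a config \<Rightarrow> real) \<Rightarrow> 'a config \<Rightarrow> 'a config \<Rightarrow> bool" where
  "distal_pair \<rho> x y \<longleftrightarrow> liminf (\<lambda>n. ereal (\<rho> (shift (int n) x) (shift (int n) y))) > 0"

definition proximal_pair :: "('a config \<Rightarrow> 'a config \<Rightarrow> real) \<Rightarrow> 'a config \<Rightarrow> 'a config \<Rightarrow> bool" where
  "proximal_pair \<rho> x y \<longleftrightarrow> liminf (\<lambda>n. ereal (\<rho> (shift (int n) x) (shift (int n) y))) = 0"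

definition asymptotic_pair :: "('a config \<Rightarrow> 'a config \<Rightarrow> real) \<Rightarrow> 'a config \<Rightarrow> 'a config \<Rightarrow> bool" where
  "asymptotic_pair \<rho> x y \<longleftrightarrow> (\<lambda>n. \<rho> (shift (int n) x) (shift (int n) y)) \<longlonglongrightarrow> 0"

definition asymptotic_pairs ::
    "'a config set \<Rightarrow> ('a config \<Rightarrow> 'a config \<Rightarrow> real) \<Rightarrow> ('a config \<times> 'a config) set" where
  "asymptotic_pairs X \<rho> = {(x, y). x \<in> X \<and> y \<in> X \<and> asymptotic_pair \<rho> x y}"

definition li_yorke_pairs ::
    "'a config set \<Rightarrow> ('a config \<Rightarrow> 'a config \<Rightarrow> real) \<Rightarrow> ('a config \<times> 'a config) set" where
  "li_yorke_pairs X \<rho> =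
     {(x, y). x \<in> X \<and> y \<in> X \<and> proximal_pair \<rho> x y \<and> \<not> asymptotic_pair \<rho> x y}"

section \<open>Expansions\<close>

definition is_expansion ::
    "nat \<Rightarrow> ('a \<Rightarrow> 'a list) \<Rightarrow> 'a config \<Rightarrow> (nat \<Rightarrow> 'a config) \<Rightarrow> (nat \<Rightarrow> nat) \<Rightarrow> bool" where
  "is_expansion p \<tau> x xs \<delta> \<longleftrightarrow>
     xs 0 = x \<and>
     (\<forall>i. xs i \<in> subst_shift \<tau> \<and> \<delta> i < p \<and>
          xs i = shift (int (\<delta> i)) (subst_config \<tau> (xs (Suc i))))"

text \<open>
  By recognizability (Dekking, Moss\'e) every point of \<open>subst_shift \<tau>\<close> has exactly one
  expansion when \<open>\<tau>\<close> is one-to-one, primitive, of constant length \<open>p \<ge> 2\<close>, and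
  \<open>subst_shift \<tau>\<close> is infinite. The definite description below is meaningful only then.
\<close>
definition expansion ::
    "nat \<Rightarrow> ('a \<Rightarrow> 'a list) \<Rightarrow> 'a config \<Rightarrow> (nat \<Rightarrow> 'a config) \<times> (nat \<Rightarrow> nat)" where
  "expansion p \<tau> x = (THE (xs, \<delta>). is_expansion p \<tau> x xs \<delta>)"

text \<open>\<open>level p \<tau> x i\<close> is $x^{(i)}$, and \<open>address p \<tau> x\<close> is $\pi(x)$.\<close>

definition level :: "nat \<Rightarrow> ('a \<Rightarrow> 'a list) \<Rightarrow> 'a config \<Rightarrow> nat \<Rightarrow> 'a config" where
  "level p \<tau> x = fst (expansion p \<tau> x)"

definition address :: "nat \<Rightarrow> ('a \<Rightarrow> 'a list) \<Rightarrow> 'a config \<Rightarrow> nat \<Rightarrow> nat" where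
  "address p \<tau> x = snd (expansion p \<tau> x)"

definition suffix_word :: "nat \<Rightarrow> ('a \<Rightarrow> 'a list) \<Rightarrow> nat \<Rightarrow> 'a config \<Rightarrow> 'a list" where
  "suffix_word p \<tau> i x = map (level p \<tau> x i) [1..int p - 1 - int (address p \<tau> x i)]"

definition I_plus :: "nat \<Rightarrow> ('a \<Rightarrow> 'a list) \<Rightarrow> 'a config \<Rightarrow> nat set" where
  "I_plus p \<tau> x = {i. length (suffix_word p \<tau> i x) \<noteq> 0}"

definition k_plus :: "nat \<Rightarrow> ('a \<Rightarrow> 'a list) \<Rightarrow> 'a config \<Rightarrow> enat" where
  "k_plus p \<tau> x =
     (if I_plus p \<tau> x = {} then 1
      else SUP i\<in>I_plus p \<tau> x.
        enat (length (x 0 # concat (map (\<lambda>j. (subst_word \<tau> ^^ j) (suffix_word p \<tau> j x)) [0..<Suc i]))))"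

text \<open>\<^const>\<open>I_plus\<close> and \<^const>\<open>k_plus\<close> depend only on \<^const>\<open>address\<close>.\<close>

lemma length_suffix_word_cong:
  assumes "address p \<tau> x = address p \<tau> y"
  shows "length (suffix_word p \<tau> i x) = length (suffix_word p \<tau> i y)"
  using assms by (simp add: suffix_word_def)

lemma I_plus_cong:
  assumes "address p \<tau> x = address p \<tau> y"
  shows "I_plus p \<tau> x = I_plus p \<tau> y"
  unfolding I_plus_def length_suffix_word_cong[OF assms] ..

lemma length_subst_word_funpow:
  assumes "constant_length p \<tau>"
  shows "length ((subst_word \<tau> ^^ n) w) = p ^ n * length w"
proof (induction n)
  case (Suc n)
  have "length (subst_word \<tau> v) = p * length v" for v
    using assms by (induction v) (simp_all add: subst_word_def constant_length_def)
  with Suc show ?case by simp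
qed simp

lemma k_plus_cong:
  assumes "constant_length p \<tau>" "address p \<tau> x = address p \<tau> y"
  shows "k_plus p \<tau> x = k_plus p \<tau> y"
  unfolding k_plus_def
  by (simp add: I_plus_cong[OF assms(2)] length_concat comp_def
      length_subst_word_funpow[OF assms(1)] length_suffix_word_cong[OF assms(2)] del: upt_Suc)

end

theory Submission
  imports Defs
begin

text \<open>
  Write $T$ for the shift, $X$ for the substitution subshift, and let the points $x^{(n)}$ and the
  digits $\delta_n$ be the expansion of $x$. Iterating the expansion gives
  $x = T^{m_n} \tau^n(x^{(n)})$ with $m_n = \sum_{i<n} \delta_i p^i < p^n$: coordinate $0$ of $x$
  is the letter number $m_n$ of the block $\tau^n(x^{(n)}_0)$, and this block ends
  $r_n = p^n - m_n$ coordinates further right. The sequence $r_n$ is non-decreasing; it is unbounded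
  exactly when infinitely many digits differ from $p-1$, that is, when $\mathcal I^+(x)$ is
  infinite, and otherwise it is eventually constant with value $k^+(x)$.

  If $x$ and $y$ have the same digits, their blocks are aligned. The word $s_n$ names the level $n$
  blocks that fill the coordinates from $r_n$ to $r_{n+1}-1$, and $\tau^n$ is injective on letters, so
  $s_n(x) = s_n(y)$ says exactly that $x$ and $y$ agree there (\<open>suffix_word_eq_iff\<close>). For unbounded
  $r_n$ these stretches exhaust a half-line. Since asymptotic means equal on a half-line
  (\<open>asymptotic_iff_eventually_equal\<close>, by compactness), this is the first claim for infinite
  $\mathcal I^+$. If $r_n$ stabilises at $k$, then $T^k x$ starts a block of every large level, its
  digits are eventually $0$, and the previous case applies to $T^k x$ and $T^k y$.

  Without coincidences, different letters in aligned blocks at level $n$ give blocks that differ at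
  every place. So if $x_i \neq y_i$ and $r_n(T^i x)$ is unbounded, then $x$ and $y$ differ
  at all coordinates from $i$ on, and the pair is distal. As $r_n(T^i x)$ is unbounded for all
  large $i$ (\<open>infinite_I_plus_shift\<close>), the failure of this hypothesis makes $x$ and $y$ eventually equal.
  Points with different digits are distal, because a long enough common window determines the
  digits (\<open>uniform_recognizability\<close>), and shifting both points changes their first different
  digits by the same amount modulo $p$. Hence there are no Li--Yorke pairs.

  Everything rests on the existence and uniqueness of expansions. Existence holds since the sets
  $T^k \tau(X)$ cover $X$, by minimality. For uniqueness (\<open>recognizability\<close>), suppose that one point lies
  in $T^a \tau(X)$ and in $T^b \tau(X)$ for different residues $a$, $b$ modulo $p$. Minimality
  spreads this to all points, so by iteration every point can be cut into blocks $\tau^n(c)$ in at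
  least $2^n$ ways modulo $p^n$. But fix one way to cut $x$ and let $w$ be the sequence of its block
  names: in any other way, the name of a block depends only on three consecutive
  letters of $w$. There are boundedly many such dependences, and two cuts with the same one would
  make $x$ periodic, which is impossible in an infinite minimal subshift.
\<close>

section \<open>The space of configurations\<close>

definition agree :: "nat \<Rightarrow> 'a config \<Rightarrow> 'a config \<Rightarrow> bool" where
  "agree M x y \<longleftrightarrow> (\<forall>i. \<bar>i\<bar> \<le> int M \<longrightarrow> x i = y i)"

lemma agree_refl [simp]: "agree M x x"
  by (simp add: agree_def)

lemma agree_sym: "agree M x y \<Longrightarrow> agree M y x"
  by (simp add: agree_def)

lemma agree_trans: "agree M x y \<Longrightarrow> agree M y z \<Longrightarrow> agree M x z"
  by (simp add: agree_def)

lemma agree_mono: "agree N x y \<Longrightarrow> M \<le> N \<Longrightarrow> agree M x y"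
  by (simp add: agree_def)

lemma agree_eqI: "(\<And>M. agree M x y) \<Longrightarrow> x = y"
proof
  fix i assume "\<And>M. agree M x y"
  from this[of "nat \<bar>i\<bar>"] show "x i = y i" by (simp add: agree_def)
qed

lemma topspace_config [simp]: "topspace config_topology = UNIV"
  by (simp add: config_topology_def)

text \<open>
  The windows $[-M, M]$ form a base of neighbourhoods, so topological questions can be settled
  with the relation \<^const>\<open>agree\<close> alone.
\<close>

lemma openin_config_iff:
  "openin config_topology U \<longleftrightarrow> (\<forall>x\<in>U. \<exists>M. \<forall>y. agree M x y \<longrightarrow> y \<in> U)"
proof
  assume U: "openin config_topology U"
  show "\<forall>x\<in>U. \<exists>M. \<forall>y. agree M x y \<longrightarrow> y \<in> U"
  proof
    fix x assume "x \<in> U"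
    with U obtain V where V: "finite {i. V i \<noteq> UNIV}" "x \<in> Pi\<^sub>E UNIV V" "Pi\<^sub>E UNIV V \<subseteq> U"
      unfolding config_topology_def openin_product_topology_alt by auto
    define M where "M = Max (insert 0 ((\<lambda>i. nat \<bar>i\<bar>) ` {i. V i \<noteq> UNIV}))"
    have "\<bar>i\<bar> \<le> int M" if "V i \<noteq> UNIV" for i
    proof -
      have "nat \<bar>i\<bar> \<le> M"
        unfolding M_def using V(1) that by (intro Max_ge) auto
      then show ?thesis by simp
    qed
    then have "y \<in> U" if "agree M x y" for y
      using that V(2,3) unfolding agree_def PiE_UNIV_domain
      by (smt (verit) Pi_iff UNIV_I subsetD)
    then show "\<exists>M. \<forall>y. agree M x y \<longrightarrow> y \<in> U" by blast
  qed
next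
  assume *: "\<forall>x\<in>U. \<exists>M. \<forall>y. agree M x y \<longrightarrow> y \<in> U"
  show "openin config_topology U"
    unfolding config_topology_def openin_product_topology_alt
  proof safe
    fix x assume "x \<in> U"
    with * obtain M where M: "\<And>y. agree M x y \<Longrightarrow> y \<in> U" by blast
    define V where "V = (\<lambda>i. if \<bar>i\<bar> \<le> int M then {x i} else UNIV)"
    have "finite {i \<in> UNIV. V i \<noteq> topspace (discrete_topology UNIV)}"
      by (rule finite_subset[of _ "{- int M..int M}"]) (auto simp: V_def split: if_splits)
    moreover have "x \<in> Pi\<^sub>E UNIV V" "Pi\<^sub>E UNIV V \<subseteq> U"
      using M by (auto simp: V_def agree_def PiE_UNIV_domain Pi_def)
    ultimately show "\<exists>V. finite {i \<in> UNIV. V i \<noteq> topspace (discrete_topology UNIV)} \<and>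
        (\<forall>i\<in>UNIV. openin (discrete_topology UNIV) (V i)) \<and> x \<in> Pi\<^sub>E UNIV V \<and> Pi\<^sub>E UNIV V \<subseteq> U"
      by auto
  qed
qed

lemma closedin_config_iff:
  "closedin config_topology S \<longleftrightarrow> (\<forall>x. (\<forall>M. \<exists>y\<in>S. agree M x y) \<longrightarrow> x \<in> S)"
  unfolding closedin_def openin_config_iff by (simp add: Ball_def) blast

text \<open>
  This is the form in which compactness of the full shift is used: the clusters
  of the tails of the sequence have the finite intersection property.
\<close>

lemma cluster_point:
  fixes X :: "nat \<Rightarrow> 'b::finite config"
  obtains x where "\<And>M N. \<exists>n\<ge>N. agree M x (X n)"
proof -
  let ?F = "\<lambda>N. config_topology closure_of (X ` {N..})"
  have "compact_space (config_topology :: 'b config topology)"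
    by (simp add: config_topology_def compact_space_product_topology
        finite_topspace_imp_discrete_topology compact_space_discrete_topology)
  moreover have "\<Inter>\<F> \<noteq> {}" if \<F>: "finite \<F>" "\<F> \<subseteq> range ?F" for \<F>
  proof -
    from finite_subset_image[OF \<F>] obtain A where A: "finite A" "\<F> = ?F ` A" by auto
    define N where "N = Max (insert 0 A)"
    have "X N \<in> ?F a" if "a \<in> A" for a
    proof -
      have "a \<le> N" unfolding N_def using A that by simp
      then show ?thesis using closure_of_subset[of "X ` {a..}" config_topology] by auto
    qed
    then show ?thesis using A by auto
  qed
  ultimately have "\<Inter>(range ?F) \<noteq> {}"
    unfolding compact_space_fip by (auto simp: closedin_closure_of)
  then obtain x where x: "\<And>N. x \<in> ?F N" by auto
  have "\<exists>n\<ge>N. agree M x (X n)" for M N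
  proof -
    have "openin config_topology {y. agree M x y}"
      unfolding openin_config_iff using agree_trans by blast
    with x[of N] have "\<exists>z\<in>X ` {N..}. z \<in> {y. agree M x y}"
      unfolding in_closure_of by (metis (no_types, lifting) agree_refl mem_Collect_eq)
    then show ?thesis by auto
  qed
  then show ?thesis using that by blast
qed

lemma closedin_limit_mem:
  fixes Y :: "'b config set"
  assumes "closedin config_topology Y" "\<And>n. Z n \<in> Y" "\<And>M N :: nat. \<exists>n\<ge>N. agree M x (Z n)"
  shows "x \<in> Y"
  using assms unfolding closedin_config_iff by metis

text \<open>
  A pair of configurations is a configuration over the alphabet of pairs.
\<close>

lemma cluster_point_pair:
  fixes X Y :: "nat \<Rightarrow> 'b::finite config"
  obtains x y where "\<And>M N. \<exists>n\<ge>N. agree M x (X n) \<and> agree M y (Y n)"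
proof -
  obtain z where z: "\<And>M N. \<exists>n\<ge>N. agree M z (\<lambda>i. (X n i, Y n i))"
    using cluster_point[of "\<lambda>n i. (X n i, Y n i)"] by blast
  have "\<exists>n\<ge>N. agree M (fst \<circ> z) (X n) \<and> agree M (snd \<circ> z) (Y n)" for M N
    using z[where M=M and N=N] by (auto simp: agree_def)
  then show ?thesis using that by blast
qed

lemma closedin_config_finite:
  assumes "finite (S :: 'b config set)"
  shows "closedin config_topology S"
proof -
  have "Hausdorff_space (config_topology :: 'b config topology)"
    by (simp add: config_topology_def Hausdorff_space_product_topology)
  then have "t1_space (config_topology :: 'b config topology)"
    by (rule Hausdorff_imp_t1_space)
  then show ?thesis
    using assms by (simp add: t1_space_closedin_finite)
qed

lemma shift_shift [simp]: "shift m (shift n x) = shift (m + n) x"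
  by (simp add: shift_def fun_eq_iff algebra_simps)

lemma shift_0 [simp]: "shift 0 x = x"
  by (simp add: shift_def)

lemma shift_apply [simp]: "shift n x i = x (i + n)"
  by (simp add: shift_def)

lemma shift_eq_iff [simp]: "shift n x = shift n y \<longleftrightarrow> x = y"
proof
  assume "shift n x = shift n y"
  then have "shift (-n) (shift n x) = shift (-n) (shift n y)" by simp
  then show "x = y" by simp
qed simp

lemma shift_image_eq_iff: "shift 1 ` Y = Y \<longleftrightarrow> (\<forall>x. shift 1 x \<in> Y \<longleftrightarrow> x \<in> Y)"
proof
  assume Y: "shift 1 ` Y = Y"
  show "\<forall>x. shift 1 x \<in> Y \<longleftrightarrow> x \<in> Y"
  proof (intro allI iffI)
    fix x assume "shift 1 x \<in> Y"
    then have "shift 1 x \<in> shift 1 ` Y" by (simp add: Y)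
    then show "x \<in> Y" by (auto simp del: shift_shift)
  next
    fix x assume "x \<in> Y"
    then have "shift 1 x \<in> shift 1 ` Y" by simp
    then show "shift 1 x \<in> Y" by (simp add: Y)
  qed
next
  assume *: "\<forall>x. shift 1 x \<in> Y \<longleftrightarrow> x \<in> Y"
  have "y \<in> shift 1 ` Y" if "y \<in> Y" for y
  proof
    show "y = shift 1 (shift (-1) y)" by simp
    show "shift (-1) y \<in> Y"
      using * that by (metis shift_shift shift_0 add.right_inverse)
  qed
  then show "shift 1 ` Y = Y" using * by auto
qed

lemma subshift_iff:
  "subshift Y \<longleftrightarrow> closedin config_topology Y \<and> (\<forall>x. shift 1 x \<in> Y \<longleftrightarrow> x \<in> Y)"
  by (simp add: subshift_def shift_image_eq_iff)

lemma subshift_shift_iff: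
  assumes "subshift Y"
  shows "shift n x \<in> Y \<longleftrightarrow> x \<in> Y"
proof (induction n rule: int_induct[where k = 0])
  case (step1 i)
  have "shift (i + 1) x = shift 1 (shift i x)" by (simp add: add.commute)
  with step1 assms show ?case by (metis subshift_iff)
next
  case (step2 i)
  have "shift i x = shift 1 (shift (i - 1) x)" by simp
  with step2 assms show ?case by (metis subshift_iff)
qed simp

section \<open>Compatible metrics\<close>

text \<open>
  On a closed, hence compact, set of configurations every compatible metric defines the same
  uniformity as the relations \<^const>\<open>agree\<close>. Each direction follows by taking cluster
  points of a sequence of counterexamples.
\<close>

context
  fixes X :: "'a::finite config set" and \<rho>
  assumes X: "closedin config_topology X" and \<rho>: "compatible_metric X \<rho>"
begin

interpretation Metric_space X \<rho>
  using \<rho> by (simp add: compatible_metric_def)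

lemma mtopology_eq: "mtopology = subtopology config_topology X"
  using \<rho> by (simp add: compatible_metric_def)

lemma metric_small_near_point:
  assumes "x \<in> X" "\<epsilon> > 0"
  obtains M where "\<And>y. y \<in> X \<Longrightarrow> agree M x y \<Longrightarrow> \<rho> x y < \<epsilon>"
proof -
  have "openin (subtopology config_topology X) (mball x \<epsilon>)"
    using openin_mball[of x \<epsilon>] by (simp add: mtopology_eq)
  then obtain U where U: "openin config_topology U" "mball x \<epsilon> = U \<inter> X"
    by (auto simp: openin_subtopology)
  moreover have "x \<in> U" using U(2) assms by (metis IntD1 centre_in_mball_iff)
  ultimately obtain M where M: "\<And>y. agree M x y \<Longrightarrow> y \<in> U"
    by (meson openin_config_iff)
  have "\<rho> x y < \<epsilon>" if "y \<in> X" "agree M x y" for y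
    using M[OF that(2)] that(1) U(2) by (metis IntI in_mball)
  then show ?thesis using that by blast
qed

lemma metric_small_if_agree:
  assumes "\<epsilon> > 0"
  obtains M where "\<And>x y. x \<in> X \<Longrightarrow> y \<in> X \<Longrightarrow> agree M x y \<Longrightarrow> \<rho> x y < \<epsilon>"
proof (rule ccontr)
  assume "\<not> thesis"
  then have "\<forall>M. \<exists>x y. x \<in> X \<and> y \<in> X \<and> agree M x y \<and> \<not> \<rho> x y < \<epsilon>"
    using that by blast
  then obtain u v where uv: "\<And>M. u M \<in> X" "\<And>M. v M \<in> X" "\<And>M. agree M (u M) (v M)"
      "\<And>M. \<not> \<rho> (u M) (v M) < \<epsilon>" by metis
  obtain x where x: "\<And>M N. \<exists>n\<ge>N. agree M x (u n)" using cluster_point by blast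
  have xX: "x \<in> X" using closedin_limit_mem[OF X] uv(1) x by meson
  obtain M where M: "\<And>y. y \<in> X \<Longrightarrow> agree M x y \<Longrightarrow> \<rho> x y < \<epsilon> / 2"
    using metric_small_near_point[OF xX, of "\<epsilon> / 2"] assms by (metis half_gt_zero)
  obtain n where n: "n \<ge> M" "agree M x (u n)" using x by blast
  then have "agree M x (v n)" using uv(3) agree_mono agree_trans by blast
  then have "\<rho> x (u n) < \<epsilon> / 2" "\<rho> x (v n) < \<epsilon> / 2" using M n uv by auto
  then have "\<rho> (u n) (v n) < \<epsilon>"
    using triangle''[OF uv(1) xX uv(2), of n n] commute[of "u n" x] by linarith
  with uv(4) show False by blast
qed

lemma agree_if_metric_small:
  obtains \<epsilon> where "\<epsilon> > 0" "\<And>x y. x \<in> X \<Longrightarrow> y \<in> X \<Longrightarrow> \<rho> x y < \<epsilon> \<Longrightarrow> agree M x y"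
proof (rule ccontr)
  assume "\<not> thesis"
  then have "\<forall>n. \<exists>x y. x \<in> X \<and> y \<in> X \<and> \<rho> x y < inverse (real (Suc n)) \<and> \<not> agree M x y"
    using that by (metis inverse_positive_iff_positive of_nat_0_less_iff zero_less_Suc)
  then obtain u v where uv: "\<And>n. u n \<in> X" "\<And>n. v n \<in> X"
      "\<And>n. \<rho> (u n) (v n) < inverse (real (Suc n))" "\<And>n. \<not> agree M (u n) (v n)" by metis
  obtain x y where xy: "\<And>M N. \<exists>n\<ge>N. agree M x (u n) \<and> agree M y (v n)"
    using cluster_point_pair by blast
  have X: "x \<in> X" "y \<in> X" using closedin_limit_mem[OF X] uv(1,2) xy by meson+
  have "\<rho> x y < \<epsilon>" if "\<epsilon> > 0" for \<epsilon>
  proof -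
    have third: "\<epsilon> / 3 > 0" using that by simp
    obtain M1 where M1: "\<And>z. z \<in> X \<Longrightarrow> agree M1 x z \<Longrightarrow> \<rho> x z < \<epsilon> / 3"
      using metric_small_near_point[OF X(1) third] by blast
    obtain M2 where M2: "\<And>z. z \<in> X \<Longrightarrow> agree M2 y z \<Longrightarrow> \<rho> y z < \<epsilon> / 3"
      using metric_small_near_point[OF X(2) third] by blast
    obtain N where N: "inverse (real (Suc N)) < \<epsilon> / 3"
      using reals_Archimedean[OF third] by blast
    obtain n where n: "n \<ge> N" "agree (max M1 M2) x (u n)" "agree (max M1 M2) y (v n)"
      using xy by blast
    have "\<rho> x (u n) < \<epsilon> / 3" "\<rho> y (v n) < \<epsilon> / 3"
      using n M1 M2 uv agree_mono by (meson max.cobounded1 max.cobounded2)+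
    moreover have "inverse (real (Suc n)) \<le> inverse (real (Suc N))"
      using n by (intro le_imp_inverse_le) auto
    ultimately show ?thesis
      using triangle[of x "u n" y] triangle[of "u n" "v n" y] X uv(1,2)[of n] uv(3)[of n] N
        commute[of y "v n"] by linarith
  qed
  then have "x = y" using X by (metis less_irrefl nonneg order_le_less zero)
  then have "\<exists>n. agree M (u n) (v n)"
    using xy[of 0 M] agree_sym agree_trans by blast
  with uv(4) show False by blast
qed

end

text \<open>
  A small distance forces equality at coordinate $0$, so a limit $0$ of the distances forces
  equality at all large coordinates; conversely, far to the right the windows of two eventually
  equal points coincide.
\<close>

lemma asymptotic_iff_eventually_equal:
  fixes X :: "'a::finite config set"
  assumes X: "subshift X" and \<rho>: "compatible_metric X \<rho>" and "x \<in> X" "y \<in> X"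
  shows "asymptotic_pair \<rho> x y \<longleftrightarrow> (\<exists>M. \<forall>j\<ge>M. x j = y j)"
proof
  interpret Metric_space X \<rho> using \<rho> by (simp add: compatible_metric_def)
  note clX = X[unfolded subshift_def, THEN conjunct1]
  have mem: "shift n x \<in> X" "shift n y \<in> X" for n
    using assms by (simp_all add: subshift_shift_iff)
  {
    assume lim: "asymptotic_pair \<rho> x y"
    obtain \<epsilon> where \<epsilon>: "\<epsilon> > 0" "\<And>x y. x \<in> X \<Longrightarrow> y \<in> X \<Longrightarrow> \<rho> x y < \<epsilon> \<Longrightarrow> agree 0 x y"
      using agree_if_metric_small[OF clX \<rho>] by blast
    from lim \<epsilon>(1) have "\<forall>\<^sub>F n in sequentially. \<rho> (shift (int n) x) (shift (int n) y) < \<epsilon>"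
      unfolding asymptotic_pair_def by (rule order_tendstoD)
    then obtain N where N: "\<And>n. n \<ge> N \<Longrightarrow> agree 0 (shift (int n) x) (shift (int n) y)"
      unfolding eventually_sequentially using \<epsilon>(2) mem by meson
    have "x j = y j" if "j \<ge> int N" for j
      using N[of "nat j"] that by (simp add: agree_def)
    then show "\<exists>M. \<forall>j\<ge>M. x j = y j" by blast
  next
    assume "\<exists>M. \<forall>j\<ge>M. x j = y j"
    then obtain M where M: "\<And>j. j \<ge> M \<Longrightarrow> x j = y j" by blast
    show "asymptotic_pair \<rho> x y"
      unfolding asymptotic_pair_def
    proof (rule order_tendstoI)
      fix a :: real assume "a < 0"
      then show "\<forall>\<^sub>F n in sequentially. a < \<rho> (shift (int n) x) (shift (int n) y)"
        by (intro always_eventually allI) (meson nonneg less_le_trans)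
    next
      fix \<epsilon> :: real assume "0 < \<epsilon>"
      then obtain K where K: "\<And>x y. x \<in> X \<Longrightarrow> y \<in> X \<Longrightarrow> agree K x y \<Longrightarrow> \<rho> x y < \<epsilon>"
        using metric_small_if_agree[OF clX \<rho>] by blast
      have "agree K (shift (int n) x) (shift (int n) y)" if "n \<ge> nat (M + int K)" for n
        using that M by (auto simp: agree_def)
      then show "\<forall>\<^sub>F n in sequentially. \<rho> (shift (int n) x) (shift (int n) y) < \<epsilon>"
        unfolding eventually_sequentially using K mem by blast
    qed
  }
qed

lemma distal_if_never_agree:
  fixes X :: "'a::finite config set"
  assumes X: "subshift X" and \<rho>: "compatible_metric X \<rho>" and "x \<in> X" "y \<in> X"
    and sep: "\<And>n. n \<ge> N \<Longrightarrow> \<not> agree M (shift (int n) x) (shift (int n) y)"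
  shows "distal_pair \<rho> x y"
proof -
  have mem: "shift n x \<in> X" "shift n y \<in> X" for n
    using assms by (simp_all add: subshift_shift_iff)
  obtain \<epsilon> where \<epsilon>: "\<epsilon> > 0" "\<And>x y. x \<in> X \<Longrightarrow> y \<in> X \<Longrightarrow> \<rho> x y < \<epsilon> \<Longrightarrow> agree M x y"
    using agree_if_metric_small X \<rho> unfolding subshift_def by blast
  have "\<epsilon> \<le> \<rho> (shift (int n) x) (shift (int n) y)" if "n \<ge> N" for n
    using \<epsilon>(2) mem sep[OF that] by (meson not_less)
  then have "\<forall>\<^sub>F n in sequentially. ereal \<epsilon> \<le> ereal (\<rho> (shift (int n) x) (shift (int n) y))"
    unfolding eventually_sequentially by auto
  then have "ereal \<epsilon> \<le> liminf (\<lambda>n. ereal (\<rho> (shift (int n) x) (shift (int n) y)))"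
    by (rule Liminf_bounded)
  with \<epsilon>(1) show ?thesis
    unfolding distal_pair_def by (meson ereal_less(2) less_le_trans)
qed

section \<open>Substitutions of constant length\<close>

locale injective_substitution =
  fixes \<tau> :: "'a::finite \<Rightarrow> 'a list" and p :: nat
  assumes const_len: "constant_length p \<tau>" and p_ge2: "p \<ge> 2" and inj_tau: "inj \<tau>"
begin

lemma length_tau [simp]: "length (\<tau> a) = p"
  using const_len by (simp add: constant_length_def)

lemma p_pos [simp]: "p > 0"
  using p_ge2 by simp

lemma p_neq0 [simp]: "p \<noteq> 0"
  using p_ge2 by simp

lemma less_p_power: "n < p ^ n"
proof -
  have "n < 2 ^ n" by simp
  also have "\<dots> \<le> p ^ n" using p_ge2 by (rule power_mono) simp
  finally show ?thesis .
qed

text \<open>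
  The letter number \<open>r\<close> of $\tau^n(a)$, found from the base-$p$ digits of \<open>r\<close>: the leading digit
  selects a letter of $\tau(a)$, the next one a letter of the image of that letter, and so on. Working
  with single letters avoids lists whose length depends on \<open>n\<close>.
\<close>

primrec letter :: "nat \<Rightarrow> 'a \<Rightarrow> nat \<Rightarrow> 'a" where
  "letter 0 a r = a"
| "letter (Suc n) a r = \<tau> (letter n a (r div p)) ! (r mod p)"

abbreviation S :: "'a config \<Rightarrow> 'a config" where
  "S \<equiv> subst_config \<tau>"

lemma length_subst_word: "length (subst_word \<tau> w) = p * length w"
  by (induction w) (simp_all add: subst_word_def)

lemma nth_subst_word:
  assumes "j < p * length w"
  shows "subst_word \<tau> w ! j = \<tau> (w ! (j div p)) ! (j mod p)"
  using assms
proof (induction w arbitrary: j)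
  case (Cons a w)
  have *: "subst_word \<tau> (a # w) = \<tau> a @ subst_word \<tau> w" by (simp add: subst_word_def)
  show ?case
  proof (cases "j < p")
    case False
    then have "subst_word \<tau> w ! (j - p) = \<tau> (w ! ((j - p) div p)) ! ((j - p) mod p)"
      using Cons.prems by (intro Cons.IH) auto
    with False show ?thesis by (simp add: * nth_append le_div_geq le_mod_geq)
  qed (simp add: * nth_append)
qed simp

lemma subst_word_funpow_single: "(subst_word \<tau> ^^ n) [a] = map (letter n a) [0..<p ^ n]"
proof (induction n)
  case (Suc n)
  have "subst_word \<tau> (map (letter n a) [0..<p ^ n]) = map (letter (Suc n) a) [0..<p ^ Suc n]"
  proof (rule nth_equalityI)
    fix j assume "j < length (subst_word \<tau> (map (letter n a) [0..<p ^ n]))"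
    then have j: "j < p * p ^ n" by (simp add: length_subst_word)
    then have "j div p < p ^ n" by (simp add: less_mult_imp_div_less mult.commute)
    with j show "subst_word \<tau> (map (letter n a) [0..<p ^ n]) ! j = map (letter (Suc n) a) [0..<p ^ Suc n] ! j"
      by (simp add: nth_subst_word)
  qed (simp add: length_subst_word)
  with Suc show ?case by simp
qed simp

lemma subst_config_nth: "S x j = \<tau> (x (j div int p)) ! nat (j mod int p)"
proof (cases "0 \<le> j")
  case True
  then obtain n where n: "j = int n" using zero_le_imp_eq_int by blast
  have "n < p * Suc n" using p_ge2 by (induction n) auto
  then have "n < p * length (map x [0..int n])" by (simp add: nat_add_distrib del: upto.simps mult_Suc_right)
  moreover have "map x [0..int n] ! (n div p) = x (int (n div p))"
    by (subst nth_map) (auto simp: less_Suc_eq_le nat_add_distrib simp flip: zdiv_int simp del: upto.simps)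
  ultimately show ?thesis
    by (simp add: subst_config_def n nth_subst_word flip: zdiv_int zmod_int del: upto.simps)
next
  case False
  then obtain n where n: "j = - int n" "n > 0"
    by (metis int_cases2 neg_0_equal_iff_equal of_nat_0 of_nat_0_le_iff gr0I)
  let ?w = "subst_word \<tau> (map x [j..-1])"
  have len: "length ?w = p * n" using n by (simp add: length_subst_word del: upto.simps)
  have "n \<le> p * n" using p_ge2 by simp
  \<comment> \<open>The index into the word is $j + np$, which is congruent to $j$ modulo $p$.\<close>
  have split: "int (p * n - n) = j + int n * int p"
    using \<open>n \<le> p * n\<close> n by (simp add: of_nat_diff algebra_simps)
  have "int (length ?w) + j = int (p * n - n)"
    unfolding split len by (simp add: algebra_simps)
  then have idx: "nat (int (length ?w) + j) = p * n - n" by (metis nat_int)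
  have d: "int ((p * n - n) div p) = j div int p + int n"
    unfolding zdiv_int split by simp
  have m: "int ((p * n - n) mod p) = j mod int p"
    unfolding zmod_int split by simp
  have "(p * n - n) div p < n"
    using n p_ge2 by (simp add: less_mult_imp_div_less mult.commute)
  then have "map x [j..-1] ! ((p * n - n) div p) = x (j + int ((p * n - n) div p))"
    using n by (simp add: nth_upto del: upto.simps)
  also have "j + int ((p * n - n) div p) = j div int p"
    using d n by simp
  finally have "map x [j..-1] ! ((p * n - n) div p) = x (j div int p)" .
  moreover have "p * n - n < p * length (map x [j..-1])"
    using n \<open>n \<le> p * n\<close> by (simp del: upto.simps)
  ultimately have "?w ! (p * n - n) = \<tau> (x (j div int p)) ! ((p * n - n) mod p)"
    by (simp add: nth_subst_word del: upto.simps)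
  also have "(p * n - n) mod p = nat (j mod int p)" using m by simp
  finally show ?thesis using False idx by (simp add: subst_config_def Let_def del: upto.simps)
qed

lemma funpow_S_nth:
  "(S ^^ n) x j = letter n (x (j div int p ^ n)) (nat (j mod int p ^ n))"
proof (induction n arbitrary: j)
  case (Suc n)
  have m: "j mod int p ^ Suc n = int p * (j div int p mod int p ^ n) + j mod int p"
    by (simp add: zmod_zmult2_eq)
  have d: "j div int p ^ Suc n = j div int p div int p ^ n"
    by (simp add: zdiv_zmult2_eq)
  have 1: "nat (j mod int p ^ Suc n) = p * nat (j div int p mod int p ^ n) + nat (j mod int p)"
    unfolding m by (simp add: nat_add_distrib nat_mult_distrib)
  have 2: "nat (j mod int p) < p" by (simp add: nat_less_iff)
  have "nat (j mod int p ^ Suc n) div p = nat (j div int p mod int p ^ n)"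
    "nat (j mod int p ^ Suc n) mod p = nat (j mod int p)"
    unfolding 1 using 2 by simp_all
  then show ?case
    by (simp add: subst_config_nth[of "(S ^^ n) x"] Suc.IH d del: power_Suc)
qed simp

text \<open>
  $\tau^{m+k}(c) = \tau^m(\tau^k(c))$, letter by letter.
\<close>

lemma letter_add:
  "letter (m + k) c r = letter m (letter k c (r div p ^ m)) (r mod p ^ m)"
proof (induction m arbitrary: r)
  case (Suc m)
  have m: "r mod p ^ Suc m = p * (r div p mod p ^ m) + r mod p"
    by (simp add: mod_mult2_eq)
  have d: "r div p ^ Suc m = r div p div p ^ m"
    by (simp add: div_mult2_eq)
  have "r mod p ^ Suc m div p = r div p mod p ^ m" "r mod p ^ Suc m mod p = r mod p"
    unfolding m by simp_all
  then show ?case using Suc.IH d by (simp del: power_Suc)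
qed simp

lemma letter_add_block:
  assumes "r < p ^ m"
  shows "letter (m + k) c (p ^ m * q + r) = letter m (letter k c q) r"
  using assms by (simp add: letter_add)

text \<open>
  Injectivity of \<open>\<tau>\<close> on letters passes to its powers because the length is constant.
\<close>

lemma letter_inject:
  assumes "\<And>r. r < p ^ n \<Longrightarrow> letter n a r = letter n b r"
  shows "a = b"
  using assms
proof (induction n)
  case (Suc n)
  show ?case
  proof (rule Suc.IH)
    fix r assume r: "r < p ^ n"
    have "\<tau> (letter n a r) ! s = \<tau> (letter n b r) ! s" if "s < p" for s
    proof -
      have "p * r + s < p * Suc r" using that by simp
      also have "\<dots> \<le> p * p ^ n" using r by (intro mult_le_mono) auto
      finally have "letter (Suc n) a (p * r + s) = letter (Suc n) b (p * r + s)"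
        by (intro Suc.prems) simp
      then show ?thesis using that by simp
    qed
    then have "\<tau> (letter n a r) = \<tau> (letter n b r)" by (intro nth_equalityI) auto
    then show "letter n a r = letter n b r" using inj_tau by (simp add: inj_eq)
  qed
qed simp

text \<open>
  Without coincidences, different letters have images that differ everywhere, so differences
  survive all powers of \<open>\<tau>\<close>.
\<close>

lemma letter_neq:
  assumes "\<not> has_coincidence \<tau>" "a \<noteq> b"
  shows "letter n a r \<noteq> letter n b r"
proof (induction n arbitrary: r)
  case (Suc n)
  have "\<tau> c ! i \<noteq> \<tau> d ! i" if "c \<noteq> d" "i < p" for c d i
    using assms(1) that unfolding has_coincidence_def words_coincide_def by auto
  with Suc show ?case by simp
qed (simp add: assms)

lemma funpow_S_shift: "(S ^^ n) (shift k x) = shift (int p ^ n * k) ((S ^^ n) x)"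
  by (simp add: fun_eq_iff funpow_S_nth add.commute)

lemma S_shift: "S (shift k x) = shift (int p * k) (S x)"
  using funpow_S_shift[of 1] by simp

lemma funpow_S_block:
  assumes "r < p ^ n"
  shows "(S ^^ n) x (int p ^ n * i + int r) = letter n (x i) r"
proof -
  have "int r < int p ^ n" using assms by (simp flip: of_nat_power)
  then show ?thesis by (simp add: funpow_S_nth)
qed

lemma funpow_S_block_inject:
  assumes "\<And>r. r < p ^ n \<Longrightarrow> (S ^^ n) x (int p ^ n * i + int r) = (S ^^ n) y (int p ^ n * k + int r)"
  shows "x i = y k"
  by (rule letter_inject[of n]) (use assms in \<open>simp add: funpow_S_block\<close>)

lemma funpow_S_eq_iff [simp]: "(S ^^ n) x = (S ^^ n) y \<longleftrightarrow> x = y"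
proof
  assume "(S ^^ n) x = (S ^^ n) y"
  then have "x i = y i" for i by (intro funpow_S_block_inject[of n x i y i]) simp
  then show "x = y" ..
qed simp

lemma S_eq_iff [simp]: "S x = S y \<longleftrightarrow> x = y"
  using funpow_S_eq_iff[of 1] by simp

lemma abs_div_p_le: "\<bar>j div int p\<bar> \<le> \<bar>j\<bar>"
proof (cases "j \<ge> 0")
  case True
  then obtain n where "j = int n" using zero_le_imp_eq_int by blast
  then show ?thesis by (simp flip: zdiv_int)
next
  case False
  then have "int p * j \<le> j" using p_ge2 by (auto simp: mult_le_cancel_right1)
  then have "j \<le> j div int p" by (metis mult.commute p_pos of_nat_0_less_iff zdiv_mono1 nonzero_mult_div_cancel_right less_irrefl)
  moreover have "j div int p < 0" using False by (simp add: pos_imp_zdiv_neg_iff)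
  ultimately show ?thesis by simp
qed

lemma agree_S: "agree M x y \<Longrightarrow> agree M (S x) (S y)"
  using abs_div_p_le unfolding agree_def subst_config_nth by (metis order_trans)

text \<open>
  The image of a compact set under a continuous map, argued with cluster points.
\<close>

lemma closedin_S_image:
  fixes Y :: "'a config set"
  assumes Y: "closedin config_topology Y"
  shows "closedin config_topology ((\<lambda>u. shift k (S u)) ` Y)"
  unfolding closedin_config_iff
proof safe
  fix x assume "\<forall>M. \<exists>y\<in>(\<lambda>u. shift k (S u)) ` Y. agree M x y"
  then have "\<forall>M. \<exists>u. u \<in> Y \<and> agree M x (shift k (S u))" by auto
  then obtain u where u: "\<And>M. u M \<in> Y" "\<And>M. agree M x (shift k (S (u M)))" by metis
  obtain v where v: "\<And>M N. \<exists>n\<ge>N. agree M v (u n)" using cluster_point by blast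
  have "v \<in> Y" using closedin_limit_mem[OF Y] u(1) v by meson
  moreover have "x = shift k (S v)"
  proof (rule agree_eqI)
    fix M
    obtain n where n: "n \<ge> M" "agree (M + nat \<bar>k\<bar>) v (u n)" using v by blast
    from agree_S[OF n(2)] have "agree M (shift k (S v)) (shift k (S (u n)))"
      by (auto simp: agree_def)
    then show "agree M x (shift k (S v))"
      using agree_mono[OF u(2) n(1)] agree_trans agree_sym by blast
  qed
  ultimately show "x \<in> (\<lambda>u. shift k (S u)) ` Y" by blast
qed

end

section \<open>Minimality of the substitution subshift\<close>

locale aperiodic_substitution = injective_substitution +
  assumes prim: "primitive \<tau>" and infinite_X: "infinite (subst_shift \<tau>)"
begin

abbreviation X :: "'a config set" where
  "X \<equiv> subst_shift \<tau>"

lemma appears_iff: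
  "appears_in ((subst_word \<tau> ^^ n) [a]) x \<longleftrightarrow> (\<exists>i. \<forall>j<p ^ n. x (i + int j) = letter n a j)"
  by (simp add: appears_in_def subst_word_funpow_single)

lemma subshift_X: "subshift X"
  unfolding subshift_iff
proof
  let ?F = "{Y. subshift Y \<and> (\<forall>n a. \<exists>x\<in>Y. appears_in ((subst_word \<tau> ^^ n) [a]) x)}"
  show "closedin config_topology X"
    unfolding closedin_config_iff
  proof (intro allI impI)
    fix x assume x: "\<forall>M. \<exists>y\<in>X. agree M x y"
    have "x \<in> Y" if "Y \<in> ?F" for Y
    proof -
      have "X \<subseteq> Y" unfolding subst_shift_def using that by (rule Inter_lower)
      then have "\<forall>M. \<exists>y\<in>Y. agree M x y" using x by blast
      then show ?thesis using that unfolding subshift_def closedin_config_iff by blast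
    qed
    then show "x \<in> X" unfolding subst_shift_def by (rule InterI)
  qed
  have "shift 1 x \<in> Y \<longleftrightarrow> x \<in> Y" if "Y \<in> ?F" for x Y
    using that by (simp add: subshift_iff)
  then show "\<forall>x. shift 1 x \<in> X \<longleftrightarrow> x \<in> X"
    unfolding subst_shift_def by blast
qed

lemma closed_X: "closedin config_topology X"
  using subshift_X by (simp add: subshift_def)

lemma shift_mem_X [simp]: "shift n x \<in> X \<longleftrightarrow> x \<in> X"
  using subshift_shift_iff[OF subshift_X] .

text \<open>
  The subshift defined by the language of \<open>\<tau>\<close>: every window occurs in some $\tau^n(c)$. It contains
  \<^const>\<open>subst_shift\<close>, and unlike the definition of the latter as an intersection it says something about
  the words that can occur in a point.
\<close>

definition factor_of_power :: "'a config \<Rightarrow> int \<Rightarrow> nat \<Rightarrow> bool" where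
  "factor_of_power x i l \<longleftrightarrow>
     (\<exists>n c s. s + l \<le> p ^ n \<and> (\<forall>j<l. x (i + int j) = letter n c (s + j)))"

definition language_shift :: "'a config set" where
  "language_shift = {x. \<forall>i l. factor_of_power x i l}"

lemma factor_of_power_cong:
  assumes "agree (nat \<bar>i\<bar> + l) x y"
  shows "factor_of_power x i l \<longleftrightarrow> factor_of_power y i l"
proof -
  have "x (i + int j) = y (i + int j)" if "j < l" for j
    using assms that by (simp add: agree_def)
  then show ?thesis unfolding factor_of_power_def by auto
qed

lemma subshift_language_shift: "subshift language_shift"
  unfolding subshift_iff
proof
  show "closedin config_topology language_shift"
    unfolding closedin_config_iff language_shift_def using factor_of_power_cong by blast
  have shifted: "factor_of_power (shift 1 x) i l \<longleftrightarrow> factor_of_power x (i + 1) l" for x i l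
    by (simp add: factor_of_power_def algebra_simps)
  have "shift 1 x \<in> language_shift \<longleftrightarrow> x \<in> language_shift" for x
  proof -
    have "shift 1 x \<in> language_shift \<longleftrightarrow> (\<forall>i l. factor_of_power (shift 1 x) i l)"
      unfolding language_shift_def by (rule mem_Collect_eq)
    also have "\<dots> \<longleftrightarrow> (\<forall>i l. factor_of_power x (i + 1) l)"
      by (simp only: shifted)
    also have "\<dots> \<longleftrightarrow> (\<forall>i l. factor_of_power x i l)"
    proof
      assume *: "\<forall>i l. factor_of_power x (i + 1) l"
      show "\<forall>i l. factor_of_power x i l"
        using *[rule_format, of "i - 1" for i] by simp
    qed simp
    also have "\<dots> \<longleftrightarrow> x \<in> language_shift"
      unfolding language_shift_def by (rule mem_Collect_eq[symmetric])
    finally show ?thesis .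
  qed
  then show "\<forall>x. shift 1 x \<in> language_shift \<longleftrightarrow> x \<in> language_shift" ..
qed

lemma primitive_exponent:
  "\<exists>N. \<forall>a b. \<exists>t<p ^ N. letter N b t = a"
proof -
  obtain N where N: "\<And>a b. a \<in> set ((subst_word \<tau> ^^ N) [b])"
    using prim unfolding primitive_def by blast
  have "\<exists>t<p ^ N. letter N b t = a" for a b
    using N[where a=a and b=b] by (auto simp: subst_word_funpow_single)
  then show ?thesis by blast
qed

text \<open>
  A point of the language subshift around a prescribed word $\tau^n(a)$: inside large powers,
  $\tau^n(a)$ occurs arbitrarily far from both ends, and a cluster point of such centred words
  has all its windows in the language.
\<close>

lemma power_in_language_shift:
  "\<exists>x\<in>language_shift. appears_in ((subst_word \<tau> ^^ n) [a]) x"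
proof -
  obtain N where N: "\<And>a b. \<exists>t<p ^ N. letter N b t = a" using primitive_exponent by blast
  have "\<exists>x. (\<forall>j<p ^ n. x (int j) = letter n a j) \<and>
      (\<forall>i l. \<bar>i\<bar> + int l \<le> int m \<longrightarrow> factor_of_power x i l)" for m
  proof -
    obtain c :: 'a where True by blast
    \<comment> \<open>In $\tau^{m+2}(c)$ the letter number $p^m$ has at least $p^m > m$ letters on both sides, as $4p^m \<le> p^{m+2}$.\<close>
    define b where "b = letter (m + 2) c (p ^ m)"
    obtain t where t: "t < p ^ N" "letter N b t = a" using N by blast
    define o' where "o' = p ^ n * (p ^ N * p ^ m + t)"
    define K where "K = n + (N + (m + 2))"
    define x where "x = (\<lambda>i. letter K c (nat (int o' + i)))"
    have le_mult: "k \<le> p ^ i * k" for i k by (simp add: Suc_le_eq)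
    have pm: "m < p ^ m" by (rule less_p_power)
    have le1: "p ^ m \<le> o'"
    proof -
      have "p ^ m \<le> p ^ N * p ^ m" by (rule le_mult)
      also have "\<dots> \<le> p ^ N * p ^ m + t" by simp
      also have "\<dots> \<le> o'" unfolding o'_def by (rule le_mult)
      finally show ?thesis .
    qed
    have le2: "o' + m \<le> p ^ K"
    proof -
      have "p ^ N * p ^ m + t \<le> p ^ N * (p ^ m + 1)" using t by (simp add: algebra_simps)
      also have "\<dots> \<le> p ^ N * (2 * p ^ m)" using pm by (intro mult_le_mono) auto
      finally have "o' \<le> p ^ n * (p ^ N * (2 * p ^ m))" unfolding o'_def by simp
      moreover have "m \<le> p ^ n * (p ^ N * (2 * p ^ m))"
        using pm le_mult[of "2 * p ^ m" N] le_mult[of "p ^ N * (2 * p ^ m)" n] by linarith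
      ultimately have "o' + m \<le> p ^ n * (p ^ N * (p ^ m * 4))" by (simp add: algebra_simps)
      also have "4 \<le> p ^ 2" using power_mono[OF p_ge2, of 2] by simp
      then have "p ^ n * (p ^ N * (p ^ m * 4)) \<le> p ^ n * (p ^ N * (p ^ m * p ^ 2))"
        by (intro mult_le_mono) auto
      also have "\<dots> = p ^ K" by (simp add: K_def power_add power2_eq_square)
      finally show ?thesis .
    qed
    have "x (int j) = letter n a j" if "j < p ^ n" for j
    proof -
      have "letter K c (o' + j) = letter n (letter (N + (m + 2)) c (p ^ N * p ^ m + t)) j"
        unfolding K_def o'_def using that by (rule letter_add_block)
      also have "letter (N + (m + 2)) c (p ^ N * p ^ m + t) = a"
        using letter_add_block[OF t(1), of "m + 2" c "p ^ m"] t(2) by (simp add: b_def)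
      finally show ?thesis by (simp add: x_def nat_add_distrib)
    qed
    moreover have "factor_of_power x i l" if "\<bar>i\<bar> + int l \<le> int m" for i l
      unfolding factor_of_power_def
    proof (intro exI conjI allI impI)
      have nonneg: "int o' + i \<ge> 0" using le1 pm that by linarith
      then show "nat (int o' + i) + l \<le> p ^ K" using le2 that by linarith
      fix j assume "j < l"
      show "x (i + int j) = letter K c (nat (int o' + i) + j)"
        using nonneg by (simp add: x_def nat_add_distrib flip: add.assoc)
    qed
    ultimately show ?thesis by blast
  qed
  then obtain Z where Z: "\<And>m j. j < p ^ n \<Longrightarrow> Z m (int j) = letter n a j"
      "\<And>m i l. \<bar>i\<bar> + int l \<le> int m \<Longrightarrow> factor_of_power (Z m) i l"
    by metis
  obtain x where x: "\<And>M N. \<exists>m\<ge>N. agree M x (Z m)" using cluster_point by blast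
  have factors: "factor_of_power x i l" for i l
  proof -
    obtain m where "m \<ge> nat \<bar>i\<bar> + l" "agree (nat \<bar>i\<bar> + l) x (Z m)" using x by blast
    then show ?thesis using Z(2)[of i l m] factor_of_power_cong by auto
  qed
  have "appears_in ((subst_word \<tau> ^^ n) [a]) x"
    unfolding appears_iff
  proof (intro exI[of _ 0] allI impI)
    fix j assume j: "j < p ^ n"
    obtain m where "agree (p ^ n) x (Z m)" using x by blast
    then have "x (int j) = Z m (int j)" using j by (simp add: agree_def)
    with j Z(1) show "x (0 + int j) = letter n a j" by simp
  qed
  moreover have "x \<in> language_shift" 
    unfolding language_shift_def by (intro CollectI allI factors)
  ultimately show ?thesis ..
qed

lemma X_subset_language_shift: "X \<subseteq> language_shift"
proof -
  have "\<forall>n a. \<exists>x\<in>language_shift. appears_in ((subst_word \<tau> ^^ n) [a]) x"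
    by (intro allI power_in_language_shift)
  with subshift_language_shift
  have "language_shift \<in> {Y. subshift Y \<and> (\<forall>n a. \<exists>x\<in>Y. appears_in ((subst_word \<tau> ^^ n) [a]) x)}"
    by (intro CollectI conjI)
  then show ?thesis
    unfolding subst_shift_def by (rule Inter_lower)
qed

text \<open>
  A window of length $2p^m$ lies in some $\tau^{n'}(c)$ and therefore contains a complete block
  $\tau^m(b)$. For $m = n + N$, where $N$ is a primitivity exponent, this block contains $\tau^n(a)$.
\<close>

lemma power_appears_in_every_point:
  assumes "y \<in> language_shift"
  shows "appears_in ((subst_word \<tau> ^^ n) [a]) y"
proof -
  obtain N where N: "\<And>a b. \<exists>t<p ^ N. letter N b t = a" using primitive_exponent by blast
  define m where "m = n + N"
  have "factor_of_power y 0 (2 * p ^ m)" using assms by (simp add: language_shift_def)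
  then obtain n' c s where s: "s + 2 * p ^ m \<le> p ^ n'"
      and y: "\<And>j. j < 2 * p ^ m \<Longrightarrow> y (int j) = letter n' c (s + j)"
    unfolding factor_of_power_def by auto
  have pm: "p ^ m > 0" by simp
  then have "p ^ m < p ^ n'" using s by linarith
  then have "m < n'" using p_ge2 by (meson power_less_imp_less_exp less_le_trans one_less_numeral_iff semiring_norm(76))
  then obtain k where k: "n' = m + k" using less_imp_add_positive by blast
  define q where "q = s div p ^ m + 1"
  define b where "b = letter k c q"
  obtain t where t: "t < p ^ N" "letter N b t = a" using N by blast
  have q: "s \<le> p ^ m * q" "p ^ m * q \<le> s + p ^ m"
  proof -
    have "p ^ m * q = p ^ m * (s div p ^ m) + p ^ m" by (simp add: q_def algebra_simps)
    moreover have "p ^ m * (s div p ^ m) + s mod p ^ m = s" by simp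
    moreover have "s mod p ^ m < p ^ m" using pm by simp
    ultimately show "s \<le> p ^ m * q" "p ^ m * q \<le> s + p ^ m" by linarith+
  qed
  show ?thesis
    unfolding appears_iff
  proof (intro exI[of _ "int (p ^ m * q - s + p ^ n * t)"] allI impI)
    fix j assume j: "j < p ^ n"
    have "p ^ n * t + j < p ^ n * Suc t" using j by simp
    also have "\<dots> \<le> p ^ m" unfolding m_def power_add using t by (intro mult_le_mono) auto
    finally have tj: "p ^ n * t + j < p ^ m" .
    have "y (int (p ^ m * q - s + p ^ n * t) + int j) = y (int (p ^ m * q - s + p ^ n * t + j))"
      by simp
    also have "\<dots> = letter n' c (s + (p ^ m * q - s + p ^ n * t + j))"
      using q tj by (intro y) linarith
    also have "s + (p ^ m * q - s + p ^ n * t + j) = p ^ m * q + (p ^ n * t + j)"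
      using q by simp
    also have "letter n' c \<dots> = letter m b (p ^ n * t + j)"
      unfolding k b_def using tj by (rule letter_add_block)
    also have "\<dots> = letter n a j"
      unfolding m_def using letter_add_block[OF j] t by simp
    finally show "y (int (p ^ m * q - s + p ^ n * t) + int j) = letter n a j" .
  qed
qed

text \<open>
  All powers of \<open>\<tau>\<close> appear in each single point of \<open>X\<close>, so a subshift meeting \<open>X\<close> takes part in the
  intersection that defines \<open>X\<close>.
\<close>

lemma minimal:
  assumes "subshift Y" "Y \<inter> X \<noteq> {}"
  shows "X \<subseteq> Y"
proof -
  obtain y where y: "y \<in> Y" "y \<in> X" using assms by blast
  then have "appears_in ((subst_word \<tau> ^^ n) [a]) y" for n a
    using power_appears_in_every_point X_subset_language_shift by blast
  with y(1) assms(1) show ?thesis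
    unfolding subst_shift_def by blast
qed

text \<open>
  The orbit of a periodic point would be a finite subshift meeting \<open>X\<close>.
\<close>

lemma not_periodic:
  assumes "x \<in> X" "k > 0"
  shows "shift k x \<noteq> x"
proof
  assume per: "shift k x = x"
  let ?Y = "(\<lambda>i. shift i x) ` {0..<k}"
  have multiples: "shift (k * i) x = x" for i
  proof (induction i rule: int_induct[where k = 0])
    case (step1 i)
    have "shift (k * (i + 1)) x = shift (k * i) (shift k x)"
      by (simp only: shift_shift distrib_left mult_1_right)
    also have "\<dots> = x" unfolding per by (rule step1)
    finally show ?case .
  next
    case (step2 i)
    have "shift (k * (i - 1)) x = shift (k * (i - 1)) (shift k x)" by (simp only: per)
    also have "\<dots> = shift (k * i) x"
      by (simp only: shift_shift right_diff_distrib mult_1_right diff_add_cancel)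
    also have "\<dots> = x" by (rule step2)
    finally show ?case .
  qed simp
  have Y: "shift i x \<in> ?Y" for i
  proof
    have "shift i x = shift (i mod k) (shift (k * (i div k)) x)" by simp
    then show "shift i x = shift (i mod k) x" by (simp only: multiples)
    show "i mod k \<in> {0..<k}" using assms(2) by simp
  qed
  have "subshift ?Y"
    unfolding subshift_iff
  proof (intro conjI allI iffI)
    show "closedin config_topology ?Y" by (rule closedin_config_finite) simp
  next
    fix z assume "shift 1 z \<in> ?Y"
    then obtain i where "shift 1 z = shift i x" by auto
    then have "shift (-1) (shift 1 z) = shift (-1) (shift i x)" by simp
    then have "z = shift (i - 1) x" by simp
    with Y show "z \<in> ?Y" by simp
  next
    fix z assume "z \<in> ?Y"
    then obtain i where "z = shift i x" by auto
    with Y show "shift 1 z \<in> ?Y" by simp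
  qed
  moreover have "x \<in> ?Y" using Y[of 0] by simp
  ultimately have "X \<subseteq> ?Y" using minimal assms(1) by blast
  then show False using infinite_X finite_subset by blast
qed

section \<open>Recognizability\<close>

definition phase :: "int \<Rightarrow> 'a config set" where
  "phase k = (\<lambda>u. shift k (S u)) ` X"

lemma closed_phase: "closedin config_topology (phase k)"
  unfolding phase_def using closed_X by (rule closedin_S_image)

lemma phase_add_p: "phase (k + int p * i) \<subseteq> phase k"
proof
  fix x assume "x \<in> phase (k + int p * i)"
  then obtain u where "u \<in> X" "x = shift (k + int p * i) (S u)" by (auto simp: phase_def)
  then have "x = shift k (S (shift i u))" "shift i u \<in> X" by (simp_all add: S_shift)
  then show "x \<in> phase k" by (auto simp: phase_def)
qed

lemma phase_mod: "phase (k mod int p) = phase k"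
proof
  have "k = k mod int p + int p * (k div int p)" by simp
  then show "phase k \<subseteq> phase (k mod int p)" using phase_add_p by metis
  have "k mod int p = k + int p * (- (k div int p))"
    by (simp add: minus_div_mult_eq_mod[symmetric])
  then show "phase (k mod int p) \<subseteq> phase k" using phase_add_p by metis
qed

lemma shift_mem_phase: "shift j x \<in> phase k \<longleftrightarrow> x \<in> phase (k - j)"
proof
  assume "shift j x \<in> phase k"
  then obtain u where u: "u \<in> X" "shift j x = shift k (S u)" by (auto simp: phase_def)
  then have "shift (- j) (shift j x) = shift (- j) (shift k (S u))" by simp
  then have "x = shift (k - j) (S u)" by simp
  with u(1) show "x \<in> phase (k - j)" by (auto simp: phase_def)
next
  assume "x \<in> phase (k - j)"
  then obtain u where "u \<in> X" "x = shift (k - j) (S u)" by (auto simp: phase_def)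
  then have "shift j x = shift k (S u)" by simp
  with \<open>u \<in> X\<close> show "shift j x \<in> phase k" by (auto simp: phase_def)
qed

text \<open>
  A window of $\tau(y)$ of length $l$ is contained in the image of a window of $y$ of length $l+1$.
\<close>

lemma S_language_shift:
  assumes "y \<in> language_shift"
  shows "S y \<in> language_shift"
proof -
  have "factor_of_power (S y) i l" for i l
  proof -
    have "factor_of_power y (i div int p) (l + 1)"
      using assms by (simp add: language_shift_def)
    then obtain n c s where s: "s + (l + 1) \<le> p ^ n"
        and y: "\<And>j. j < l + 1 \<Longrightarrow> y (i div int p + int j) = letter n c (s + j)"
      unfolding factor_of_power_def by auto
    define e where "e = nat (i mod int p)"
    have e: "int e = i mod int p" "e < p" by (simp_all add: e_def nat_less_iff)
    show ?thesis
      unfolding factor_of_power_def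
    proof (intro exI conjI allI impI)
      have "p * s + e + l \<le> p * s + p * 1 + p * l" using e by (intro add_mono) auto
      also have "\<dots> = p * (s + (l + 1))" by (simp add: algebra_simps)
      also have "\<dots> \<le> p * p ^ n" using s by (rule mult_le_mono2)
      finally show "p * s + e + l \<le> p ^ Suc n" by simp
    next
      fix j assume "j < l"
      have split: "i + int j = int (e + j) + int p * (i div int p)" by (simp add: e)
      have d: "(i + int j) div int p = i div int p + int ((e + j) div p)"
        unfolding zdiv_int by (subst split) simp
      have m: "(i + int j) mod int p = int ((e + j) mod p)"
        unfolding zmod_int by (subst split) simp
      have "l \<le> l * p" by (simp add: Suc_le_eq)
      then have "e + j < (l + 1) * p" using e(2) \<open>j < l\<close> unfolding distrib_right by linarith
      then have "(e + j) div p < l + 1" by (simp add: less_mult_imp_div_less)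
      then have "S y (i + int j) = \<tau> (letter n c (s + (e + j) div p)) ! ((e + j) mod p)"
        by (simp add: subst_config_nth d m y)
      also have "\<dots> = letter (Suc n) c (p * s + e + j)"
        by (simp add: add.assoc)
      finally show "S y (i + int j) = letter (Suc n) c (p * s + e + j)" .
    qed
  qed
  then show ?thesis
    unfolding language_shift_def by (intro CollectI allI)
qed

text \<open>
  The union of the sets $T^k \tau(X)$ is a subshift in which all powers of \<open>\<tau>\<close> appear.
\<close>

lemma phases_cover: "X \<subseteq> (\<Union>k\<in>{0..<int p}. phase k)"
proof -
  let ?Y = "\<Union>k\<in>{0..<int p}. phase k"
  have mem: "x \<in> ?Y \<longleftrightarrow> (\<exists>k. x \<in> phase k)" for x
  proof
    assume "\<exists>k. x \<in> phase k"
    then obtain k where "x \<in> phase k" ..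
    then have "x \<in> phase (k mod int p)" by (simp add: phase_mod)
    then show "x \<in> ?Y" by auto
  qed auto
  have "subshift ?Y"
    unfolding subshift_iff
  proof
    show "closedin config_topology ?Y" by (intro closedin_Union) (auto simp: closed_phase)
    show "\<forall>x. shift 1 x \<in> ?Y \<longleftrightarrow> x \<in> ?Y"
      unfolding mem shift_mem_phase by (metis add_diff_cancel)
  qed
  moreover have "\<forall>n a. \<exists>x\<in>?Y. appears_in ((subst_word \<tau> ^^ n) [a]) x"
  proof (intro allI)
    fix n a
    have "X \<noteq> {}" using infinite_X by auto
    then obtain y where y: "y \<in> X" by blast
    have "y \<in> language_shift" using y X_subset_language_shift by (rule rev_subsetD)
    then have "appears_in ((subst_word \<tau> ^^ n) [a]) (S y)"
      by (intro power_appears_in_every_point S_language_shift)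
    moreover have "S y \<in> phase 0" using y by (auto simp: phase_def)
    then have "S y \<in> ?Y" unfolding mem by (rule exI)
    ultimately show "\<exists>x\<in>?Y. appears_in ((subst_word \<tau> ^^ n) [a]) x" by (rule bexI)
  qed
  ultimately have "?Y \<in> {Y. subshift Y \<and> (\<forall>n a. \<exists>x\<in>Y. appears_in ((subst_word \<tau> ^^ n) [a]) x)}"
    by (intro CollectI conjI)
  then show ?thesis
    unfolding subst_shift_def by (rule Inter_lower)
qed

lemma desubstitute:
  assumes "x \<in> X"
  obtains u a where "u \<in> X" "a < p" "x = shift (int a) (S u)"
proof -
  obtain k where k: "0 \<le> k" "k < int p" "x \<in> phase k"
    using assms phases_cover by fastforce
  then obtain u where "u \<in> X" "x = shift (int (nat k)) (S u)" by (auto simp: phase_def)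
  with k that show ?thesis by (metis nat_less_iff)
qed

text \<open>
  The residues modulo $p^n$ at which \<open>x\<close> can be cut into blocks $\tau^n(c)$. Recognizability means that
  there is only one.
\<close>

definition cuts :: "nat \<Rightarrow> 'a config \<Rightarrow> nat set" where
  "cuts n x = {a. a < p ^ n \<and> (\<exists>u\<in>X. x = shift (int a) ((S ^^ n) u))}"

lemma finite_cuts [simp]: "finite (cuts n x)"
  by (rule finite_subset[of _ "{..<p ^ n}"]) (auto simp: cuts_def)

lemma cuts_1: "cuts 1 x = {a. a < p \<and> x \<in> phase (int a)}"
  by (auto simp: cuts_def phase_def)

text \<open>
  The points with two different cuts modulo $p$ form a subshift, being a finite union of intersections
  of closed sets that the shift permutes. By minimality it contains \<open>X\<close> once it meets it.
\<close>

lemma ambiguity_spreads: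
  assumes "x \<in> X" "2 \<le> card (cuts 1 x)" "y \<in> X"
  shows "2 \<le> card (cuts 1 y)"
proof -
  let ?P = "{(a, b). a \<in> {0..<int p} \<and> b \<in> {0..<int p} \<and> a \<noteq> b}"
  define Z where "Z = (\<Union>(a, b)\<in>?P. phase a \<inter> phase b)"
  have mem: "z \<in> Z \<longleftrightarrow> (\<exists>a b. a mod int p \<noteq> b mod int p \<and> z \<in> phase a \<and> z \<in> phase b)" for z
  proof
    assume "z \<in> Z"
    then obtain a b where "a \<in> {0..<int p}" "b \<in> {0..<int p}" "a \<noteq> b" "z \<in> phase a" "z \<in> phase b"
      by (auto simp: Z_def)
    then show "\<exists>a b. a mod int p \<noteq> b mod int p \<and> z \<in> phase a \<and> z \<in> phase b"
      by (intro exI[of _ a] exI[of _ b]) simp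
  next
    assume "\<exists>a b. a mod int p \<noteq> b mod int p \<and> z \<in> phase a \<and> z \<in> phase b"
    then obtain a b where "a mod int p \<noteq> b mod int p" "z \<in> phase (a mod int p)" "z \<in> phase (b mod int p)"
      by (auto simp: phase_mod)
    then show "z \<in> Z"
      unfolding Z_def by (intro UN_I[of "(a mod int p, b mod int p)"]) auto
  qed
  have "finite ?P"
    by (rule finite_subset[of _ "{0..<int p} \<times> {0..<int p}"]) auto
  then have closed: "closedin config_topology Z"
    unfolding Z_def by (intro closedin_Union) (auto simp: closed_phase)
  have "shift 1 z \<in> Z \<longleftrightarrow> z \<in> Z" for z
  proof -
    have "(\<exists>a b. a mod int p \<noteq> b mod int p \<and> z \<in> phase (a - 1) \<and> z \<in> phase (b - 1)) \<longleftrightarrow>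
        (\<exists>a b. a mod int p \<noteq> b mod int p \<and> z \<in> phase a \<and> z \<in> phase b)"
    proof
      assume "\<exists>a b. a mod int p \<noteq> b mod int p \<and> z \<in> phase (a - 1) \<and> z \<in> phase (b - 1)"
      then obtain a b where ab: "a mod int p \<noteq> b mod int p" "z \<in> phase (a - 1)" "z \<in> phase (b - 1)"
        by blast
      then have "(a - 1) mod int p \<noteq> (b - 1) mod int p"
        by (metis diff_add_cancel mod_add_left_eq)
      with ab show "\<exists>a b. a mod int p \<noteq> b mod int p \<and> z \<in> phase a \<and> z \<in> phase b" by blast
    next
      assume "\<exists>a b. a mod int p \<noteq> b mod int p \<and> z \<in> phase a \<and> z \<in> phase b"
      then obtain a b where ab: "a mod int p \<noteq> b mod int p" "z \<in> phase a" "z \<in> phase b"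
        by blast
      then have "(a + 1) mod int p \<noteq> (b + 1) mod int p"
        by (metis add_diff_cancel_right' mod_diff_left_eq)
      with ab show "\<exists>a b. a mod int p \<noteq> b mod int p \<and> z \<in> phase (a - 1) \<and> z \<in> phase (b - 1)"
        by (intro exI[of _ "a + 1"] exI[of _ "b + 1"]) simp
    qed
    then show ?thesis unfolding mem shift_mem_phase .
  qed
  then have "\<forall>z. shift 1 z \<in> Z \<longleftrightarrow> z \<in> Z" ..
  with closed have "subshift Z" unfolding subshift_iff by (rule conjI)
  moreover have "x \<in> Z"
  proof -
    obtain T where "T \<subseteq> cuts 1 x" "card T = 2"
      using assms(2) by (meson obtain_subset_with_card_n)
    then obtain a b where "a \<in> cuts 1 x" "b \<in> cuts 1 x" "a \<noteq> b"
      by (auto simp: card_2_iff)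
    then show ?thesis unfolding cuts_1 Z_def by (intro UN_I[of "(int a, int b)"]) auto
  qed
  ultimately have "X \<subseteq> Z" using assms(1) by (intro minimal) auto
  then have "y \<in> Z" using assms(3) by (rule subsetD)
  then obtain a b where "a \<in> {0..<int p}" "b \<in> {0..<int p}" "a \<noteq> b" "y \<in> phase a" "y \<in> phase b"
    by (auto simp: Z_def)
  then have "{nat a, nat b} \<subseteq> cuts 1 y" "nat a \<noteq> nat b"
    unfolding cuts_1 by auto
  then show ?thesis using card_mono[of "cuts 1 y" "{nat a, nat b}"] by simp
qed

text \<open>
  Each cut of \<open>x\<close> modulo $p^n$ yields a point $u$ of block names, and each of the cuts of $u$ modulo
  $p$ refines it to a cut of \<open>x\<close> modulo $p^{n+1}$. Different choices give different residues.
\<close>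

lemma card_cuts_lower:
  assumes amb: "\<And>x. x \<in> X \<Longrightarrow> 2 \<le> card (cuts 1 x)" and "x \<in> X"
  shows "2 ^ n \<le> card (cuts n x)"
proof (induction n)
  case 0
  have "cuts 0 x = {0}" using \<open>x \<in> X\<close> by (auto simp: cuts_def)
  then show ?case by simp
next
  case (Suc n)
  have "\<forall>a\<in>cuts n x. \<exists>u. u \<in> X \<and> x = shift (int a) ((S ^^ n) u)"
    by (auto simp: cuts_def)
  then obtain u where u: "\<And>a. a \<in> cuts n x \<Longrightarrow> u a \<in> X"
      "\<And>a. a \<in> cuts n x \<Longrightarrow> x = shift (int a) ((S ^^ n) (u a))"
    by (metis (no_types, lifting))
  define f where "f = (\<lambda>(a, i). a + p ^ n * i)"
  define D where "D = (SIGMA a : cuts n x. cuts 1 (u a))"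
  have "inj_on f D"
  proof (rule inj_onI, clarify)
    fix a i b k
    assume "(a, i) \<in> D" "(b, k) \<in> D" and eq: "f (a, i) = f (b, k)"
    then have "a < p ^ n" "b < p ^ n" by (auto simp: D_def cuts_def)
    moreover have "f (a, i) mod p ^ n = a mod p ^ n" "f (b, k) mod p ^ n = b mod p ^ n"
      by (simp_all add: f_def)
    ultimately have "a = b" using eq by simp
    with eq show "a = b \<and> i = k" by (simp add: f_def)
  qed
  moreover have "f ` D \<subseteq> cuts (Suc n) x"
  proof clarify
    fix a i assume "(a, i) \<in> D"
    then have a: "a \<in> cuts n x" "a < p ^ n" and i: "i \<in> cuts 1 (u a)" "i < p"
      by (auto simp: D_def cuts_def)
    from i(1) obtain v where v: "v \<in> X" "u a = shift (int i) (S v)"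
      by (auto simp: cuts_def)
    have "x = shift (int a) ((S ^^ n) (shift (int i) (S v)))"
      using u(2)[OF a(1)] v(2) by simp
    also have "\<dots> = shift (int (f (a, i))) ((S ^^ Suc n) v)"
      by (simp add: funpow_S_shift f_def funpow_swap1)
    finally have "x = shift (int (f (a, i))) ((S ^^ Suc n) v)" .
    moreover have "f (a, i) < p ^ Suc n"
    proof -
      have "f (a, i) < p ^ n * Suc i" using a by (simp add: f_def)
      also have "\<dots> \<le> p ^ n * p" using i by (intro mult_le_mono) auto
      finally show ?thesis by (simp add: mult.commute)
    qed
    ultimately show "f (a, i) \<in> cuts (Suc n) x" using v(1) unfolding cuts_def by blast
  qed
  ultimately have "card D \<le> card (cuts (Suc n) x)"
    by (intro card_inj_on_le) auto
  moreover have "card D = (\<Sum>a\<in>cuts n x. card (cuts 1 (u a)))"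
    unfolding D_def by (simp add: card_SigmaI)
  moreover have "(\<Sum>a\<in>cuts n x. 2) \<le> (\<Sum>a\<in>cuts n x. card (cuts 1 (u a)))"
    using amb u(1) by (intro sum_mono) blast
  ultimately show ?case using Suc by simp
qed

text \<open>
  Fix a cut at residue \<open>b\<close> with block names \<open>w\<close>. A block of another cut overlaps only blocks
  of the fixed one in adjacent positions, so by injectivity of $\tau^n$ its name is a function of
  three consecutive letters of \<open>w\<close>. Two cuts with the same function have the same block names, so
  that \<open>x\<close> is mapped to itself by the difference of their residues. Thus the number of cuts
  is bounded by the number of three-letter functions, independently of \<open>n\<close>.
\<close>

lemma card_cuts_upper:
  assumes "x \<in> X"
  shows "card (cuts n x) \<le> card (UNIV :: ('a \<times> 'a \<times> 'a \<Rightarrow> 'a) set)"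
proof (cases "cuts n x = {}")
  case False
  then obtain b where b: "b \<in> cuts n x" by blast
  then obtain w where w: "x = shift (int b) ((S ^^ n) w)" by (auto simp: cuts_def)
  have "\<forall>a\<in>cuts n x. \<exists>u. u \<in> X \<and> x = shift (int a) ((S ^^ n) u)"
    by (auto simp: cuts_def)
  then obtain u where u: "\<And>a. a \<in> cuts n x \<Longrightarrow> u a \<in> X"
      "\<And>a. a \<in> cuts n x \<Longrightarrow> x = shift (int a) ((S ^^ n) (u a))"
    by (metis (no_types, lifting))
  let ?w3 = "\<lambda>i. (w (i - 1), w i, w (i + 1))"
  have block_code: "u a i = u a k" if a: "a \<in> cuts n x" and eq: "?w3 i = ?w3 k" for a i k
  proof (rule funpow_S_block_inject)
    fix r assume r: "r < p ^ n"
    define d where "d = int b - int a"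
    have "a < p ^ n" "b < p ^ n" using a b by (simp_all add: cuts_def)
    then have "int a < int p ^ n" "int b < int p ^ n" by (simp_all flip: of_nat_power)
    then have d: "- (int p ^ n) < d" "d < int p ^ n" unfolding d_def by linarith+
    have "shift (- int a) x = (S ^^ n) (u a)" "shift (- int a) x = shift d ((S ^^ n) w)"
      by (subst u(2)[OF a], simp) (subst w, simp add: d_def)
    then have 1: "(S ^^ n) (u a) j = (S ^^ n) w (j + d)" for j
      by (metis shift_apply)
    \<comment> \<open>The position relative to the block number $i$ of the fixed cut.\<close>
    define e where "e = int r + d"
    have P: "int p ^ n > 0" by simp
    have "- (int p ^ n) \<le> e" "e < 2 * int p ^ n"
    proof -
      have "int r < int p ^ n" using r by (simp flip: of_nat_power)
      with d show "- (int p ^ n) \<le> e" "e < 2 * int p ^ n" unfolding e_def by (-, linarith+)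
    qed
    then have "(e + int p ^ n) div int p ^ n \<ge> 0" "(e - 2 * int p ^ n) div int p ^ n < 0"
      using P by (simp_all only: pos_imp_zdiv_nonneg_iff pos_imp_zdiv_neg_iff)
    moreover have "e - 2 * int p ^ n = e + (- 2) * int p ^ n" by simp
    then have "(e - 2 * int p ^ n) div int p ^ n = e div int p ^ n - 2"
      using P by (simp only: div_mult_self1)
    ultimately have "-1 \<le> e div int p ^ n" "e div int p ^ n < 2"
      using P by simp_all
    then have "e div int p ^ n \<in> {-1, 0, 1}" by auto
    then have "w (i + e div int p ^ n) = w (k + e div int p ^ n)" using eq by auto
    moreover have "(S ^^ n) (u a) (int p ^ n * h + int r) =
        letter n (w (h + e div int p ^ n)) (nat (e mod int p ^ n))" for h
    proof -
      have "int p ^ n * h + int r + d = e + int p ^ n * h" by (simp add: e_def)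
      then have "(S ^^ n) (u a) (int p ^ n * h + int r) = (S ^^ n) w (e + int p ^ n * h)"
        by (simp only: 1)
      then show ?thesis using P by (simp add: funpow_S_nth[of n w] add.commute)
    qed
    ultimately show "(S ^^ n) (u a) (int p ^ n * i + int r) = (S ^^ n) (u a) (int p ^ n * k + int r)"
      by simp
  qed
  define f where "f = (\<lambda>a t. u a (SOME i. ?w3 i = t))"
  have f: "u a i = f a (?w3 i)" if "a \<in> cuts n x" for a i
  proof -
    define k where "k = (SOME k. ?w3 k = ?w3 i)"
    have "?w3 k = ?w3 i" unfolding k_def by (rule someI) (rule refl)
    then have "u a k = u a i" by (rule block_code[OF that])
    then show ?thesis by (simp add: f_def k_def)
  qed
  have False if "a \<in> cuts n x" "c \<in> cuts n x" "f a = f c" "a < c" for a c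
  proof -
    have "u a = u c" using f that by (metis ext)
    have "shift (int c - int a) x = shift (int c - int a) (shift (int a) ((S ^^ n) (u a)))"
      using u(2)[OF that(1)] by simp
    also have "\<dots> = shift (int c) ((S ^^ n) (u c))" by (simp add: \<open>u a = u c\<close>)
    also have "\<dots> = x" using u(2)[OF that(2)] by simp
    finally show False using not_periodic[OF assms, of "int c - int a"] that(4) by simp
  qed
  then have "inj_on f (cuts n x)"
    by (metis inj_onI linorder_neqE_nat)
  then show ?thesis by (intro card_inj_on_le) auto
qed simp

text \<open>
  Two cuts modulo $p$ of a single point would multiply to $2^n$ cuts modulo $p^n$ of that point,
  against the bound that does not depend on $n$.
\<close>

theorem recognizability:
  assumes x: "x \<in> X" and "u \<in> X" "v \<in> X" "a < p" "b < p"
    and eq: "x = shift (int a) (S u)" "x = shift (int b) (S v)"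
  shows "a = b \<and> u = v"
proof -
  have "a = b"
  proof (rule ccontr)
    assume "a \<noteq> b"
    moreover have "x \<in> phase (int a)" "x \<in> phase (int b)"
      using assms(2,3) eq unfolding phase_def by blast+
    then have "{a, b} \<subseteq> cuts 1 x" using assms(4,5) unfolding cuts_1 by simp
    ultimately have "2 \<le> card (cuts 1 x)"
      using card_mono[of "cuts 1 x" "{a, b}"] by simp
    then have "2 \<le> card (cuts 1 y)" if "y \<in> X" for y
      using ambiguity_spreads[OF x] that by blast
    then have "2 ^ n \<le> card (cuts n x)" for n
      using x by (rule card_cuts_lower)
    then have bound: "2 ^ n \<le> card (UNIV :: ('a \<times> 'a \<times> 'a \<Rightarrow> 'a) set)" for n :: nat
      using card_cuts_upper[OF x, of n] by (rule order_trans)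
    have "N < 2 ^ N" for N :: nat by simp
    with bound show False by (meson not_less)
  qed
  with eq show ?thesis by simp
qed

text \<open>
  By compactness, the disjoint closed sets $T^a \tau(X)$ and $T^b \tau(X)$ are separated by the contents
  of a window, so points that agree on a large window have the same digit. Their
  desubstitutions then have equal images on the window, hence agree on a window about $p$
  times smaller.
\<close>

lemma uniform_recognizability:
  obtains M where
    "\<And>x y u v a b. \<lbrakk>x \<in> X; y \<in> X; u \<in> X; v \<in> X; a < p; b < p; x = shift (int a) (S u);
       y = shift (int b) (S v); agree M x y\<rbrakk> \<Longrightarrow> a = b \<and> agree M' u v"
proof -
  have sep: "\<exists>M. \<forall>x\<in>X \<inter> phase (int a). \<forall>y\<in>X \<inter> phase (int b). \<not> agree M x y"
    if "a < p" "b < p" "a \<noteq> b" for a b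
  proof (rule ccontr)
    assume "\<not> ?thesis"
    then obtain x y where xy: "\<And>M. x M \<in> X \<inter> phase (int a)" "\<And>M. y M \<in> X \<inter> phase (int b)"
        "\<And>M. agree M (x M) (y M)" by metis
    obtain z where z: "\<And>M N. \<exists>n\<ge>N. agree M z (x n)" using cluster_point by blast
    have z': "\<exists>n\<ge>N. agree M z (y n)" for M N
    proof -
      obtain n where "n \<ge> max M N" "agree M z (x n)" using z by blast
      then show ?thesis using xy(3)[of n] agree_mono agree_trans by (metis max.boundedE)
    qed
    have closed: "closedin config_topology (X \<inter> phase k)" for k
      using closed_X closed_phase by (rule closedin_Int)
    have "z \<in> X \<inter> phase (int a)" by (rule closedin_limit_mem[of "X \<inter> phase (int a)" x, OF closed xy(1) z])
    moreover have "z \<in> X \<inter> phase (int b)" by (rule closedin_limit_mem[of "X \<inter> phase (int b)" y, OF closed xy(2) z'])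
    ultimately obtain u v where "z \<in> X" "u \<in> X" "v \<in> X"
        "z = shift (int a) (S u)" "z = shift (int b) (S v)"
      unfolding phase_def by blast
    then have "a = b" using recognizability that(1,2) by blast
    with that show False by simp
  qed
  have "\<forall>\<^sub>F M in sequentially. \<forall>ab\<in>{..<p} \<times> {..<p}. fst ab \<noteq> snd ab \<longrightarrow>
      (\<forall>x\<in>X \<inter> phase (int (fst ab)). \<forall>y\<in>X \<inter> phase (int (snd ab)). \<not> agree M x y)"
  proof (intro eventually_ball_finite ballI)
    fix ab assume "ab \<in> {..<p} \<times> {..<p}"
    then have ab: "fst ab < p" "snd ab < p" by auto
    show "\<forall>\<^sub>F M in sequentially. fst ab \<noteq> snd ab \<longrightarrow>
      (\<forall>x\<in>X \<inter> phase (int (fst ab)). \<forall>y\<in>X \<inter> phase (int (snd ab)). \<not> agree M x y)"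
    proof (cases "fst ab = snd ab")
      case False
      from sep[OF ab False]
      obtain M where M: "\<forall>x\<in>X \<inter> phase (int (fst ab)). \<forall>y\<in>X \<inter> phase (int (snd ab)). \<not> agree M x y" ..
      show ?thesis
        unfolding eventually_sequentially
      proof (intro exI[of _ M] allI impI ballI notI)
        fix N x y
        assume *: "N \<ge> M" "x \<in> X \<inter> phase (int (fst ab))" "y \<in> X \<inter> phase (int (snd ab))" "agree N x y"
        have "agree M x y" using *(4,1) by (rule agree_mono)
        moreover have "\<not> agree M x y" by (rule bspec[OF bspec[OF M *(2)] *(3)])
        ultimately show False by (rule notE[rotated])
      qed
    qed simp
  qed simp
  then obtain K where K: "\<And>M. M \<ge> K \<Longrightarrow> \<forall>ab\<in>{..<p} \<times> {..<p}. fst ab \<noteq> snd ab \<longrightarrow>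
      (\<forall>x\<in>X \<inter> phase (int (fst ab)). \<forall>y\<in>X \<inter> phase (int (snd ab)). \<not> agree M x y)"
    unfolding eventually_sequentially by blast
  have same_phase: "a = b" if *: "M \<ge> K" "a < p" "b < p" "x \<in> X \<inter> phase (int a)"
      "y \<in> X \<inter> phase (int b)" "agree M x y" for a b x y M
  proof (rule ccontr)
    assume "a \<noteq> b"
    moreover have "(a, b) \<in> {..<p} \<times> {..<p}" using *(2,3) by simp
    from bspec[OF K[OF *(1)] this] have "a \<noteq> b \<longrightarrow>
        (\<forall>x\<in>X \<inter> phase (int a). \<forall>y\<in>X \<inter> phase (int b). \<not> agree M x y)"
      unfolding fst_conv snd_conv .
    ultimately have "\<not> agree M x y" using *(4,5) by blast
    then show False using *(6) by (rule notE)
  qed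
  show ?thesis
  proof (rule that[of "K + p * (M' + 1)"])
    fix x y u v a b
    assume *: "x \<in> X" "y \<in> X" "u \<in> X" "v \<in> X" "a < p" "b < p" "x = shift (int a) (S u)"
       "y = shift (int b) (S v)" "agree (K + p * (M' + 1)) x y"
    have "x \<in> X \<inter> phase (int a)" "y \<in> X \<inter> phase (int b)"
      using *(1-4,7,8) unfolding phase_def by blast+
    from same_phase[OF _ *(5,6) this *(9)] have "a = b" by simp
    moreover have "u i = v i" if "\<bar>i\<bar> \<le> int M'" for i
    proof (rule funpow_S_block_inject[of 1])
      fix r assume "r < p ^ 1"
      define j where "j = int p * i + int r - int a"
      have "\<bar>int p * i\<bar> \<le> int p * int M'" using that by (simp add: abs_mult mult_left_mono)
      then have "\<bar>j\<bar> \<le> int (K + p * (M' + 1))"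
        using \<open>r < p ^ 1\<close> \<open>a < p\<close> unfolding j_def by (simp add: algebra_simps)
      then have "x j = y j" using *(9) by (simp add: agree_def)
      then show "(S ^^ 1) u (int p ^ 1 * i + int r) = (S ^^ 1) v (int p ^ 1 * i + int r)"
        using *(7,8) \<open>a = b\<close> by (simp add: j_def)
    qed
    ultimately show "a = b \<and> agree M' u v" by (simp add: agree_def)
  qed
qed

section \<open>Expansions\<close>

lemma expansion_exists:
  assumes "x \<in> X"
  shows "\<exists>xs \<delta>. is_expansion p \<tau> x xs \<delta>"
proof -
  have "\<forall>x\<in>X. \<exists>ua. fst ua \<in> X \<and> snd ua < p \<and> x = shift (int (snd ua)) (S (fst ua))"
    using desubstitute by (metis fst_conv snd_conv)
  then obtain g where g: "\<And>x. x \<in> X \<Longrightarrow> fst (g x) \<in> X"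
      "\<And>x. x \<in> X \<Longrightarrow> snd (g x) < p" "\<And>x. x \<in> X \<Longrightarrow> x = shift (int (snd (g x))) (S (fst (g x)))"
    by (metis (no_types, lifting))
  define xs where "xs = (\<lambda>i. ((\<lambda>x. fst (g x)) ^^ i) x)"
  have mem: "xs i \<in> X" for i
    by (induction i) (simp_all add: xs_def assms g(1))
  have step: "xs (Suc i) = fst (g (xs i))" for i
    by (simp add: xs_def)
  have "is_expansion p \<tau> x xs (\<lambda>i. snd (g (xs i)))"
    unfolding is_expansion_def step using g(2)[OF mem] g(3)[OF mem] mem by (simp add: xs_def)
  then show ?thesis by blast
qed

lemma expansion_unique:
  assumes "is_expansion p \<tau> x xs \<delta>" "is_expansion p \<tau> x ys \<epsilon>"
  shows "xs = ys \<and> \<delta> = \<epsilon>"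
proof -
  have step: "\<delta> i = \<epsilon> i \<and> xs (Suc i) = ys (Suc i)" if "xs i = ys i" for i
  proof (rule recognizability)
    show "xs i \<in> X" "xs (Suc i) \<in> X" "ys (Suc i) \<in> X" "\<delta> i < p" "\<epsilon> i < p"
      "xs i = shift (int (\<delta> i)) (S (xs (Suc i)))"
      using assms unfolding is_expansion_def by blast+
    show "xs i = shift (int (\<epsilon> i)) (S (ys (Suc i)))"
      unfolding that using assms(2) unfolding is_expansion_def by blast
  qed
  have eq: "xs i = ys i" for i
  proof (induction i)
    case 0
    have "xs 0 = x" "ys 0 = x" using assms unfolding is_expansion_def by blast+
    then show ?case by simp
  next
    case (Suc i)
    show ?case by (rule conjunct2[OF step[OF Suc.IH]])
  qed
  have "\<delta> i = \<epsilon> i" for i by (rule conjunct1[OF step[OF eq]])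
  then have "\<delta> = \<epsilon>" ..
  moreover have "xs = ys" by (rule ext) (rule eq)
  ultimately show ?thesis by simp
qed

lemma expansion_eqI:
  assumes "is_expansion p \<tau> x xs \<delta>"
  shows "level p \<tau> x = xs" "address p \<tau> x = \<delta>"
proof -
  have "expansion p \<tau> x = (xs, \<delta>)"
    unfolding expansion_def
  proof (rule the_equality)
    show "case (xs, \<delta>) of (xs, \<delta>) \<Rightarrow> is_expansion p \<tau> x xs \<delta>" using assms by simp
    fix e assume "case e of (ys, \<epsilon>) \<Rightarrow> is_expansion p \<tau> x ys \<epsilon>"
    then have "is_expansion p \<tau> x (fst e) (snd e)" by (simp add: case_prod_beta)
    from expansion_unique[OF this assms] show "e = (xs, \<delta>)" by (simp add: prod_eq_iff)
  qed
  then show "level p \<tau> x = xs" "address p \<tau> x = \<delta>" by (simp_all add: level_def address_def)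
qed

abbreviation lev :: "'a config \<Rightarrow> nat \<Rightarrow> 'a config" where
  "lev \<equiv> level p \<tau>"

abbreviation addr :: "'a config \<Rightarrow> nat \<Rightarrow> nat" where
  "addr \<equiv> address p \<tau>"

lemma is_expansion_level:
  assumes "x \<in> X"
  shows "is_expansion p \<tau> x (lev x) (addr x)"
proof -
  obtain xs \<delta> where e: "is_expansion p \<tau> x xs \<delta>" using expansion_exists[OF assms] by blast
  show ?thesis unfolding expansion_eqI[OF e] by (rule e)
qed

lemma
  assumes "x \<in> X"
  shows level_0: "lev x 0 = x"
    and level_in_X: "lev x n \<in> X"
    and address_less: "addr x n < p"
    and level_step: "lev x n = shift (int (addr x n)) (S (lev x (Suc n)))"
  using is_expansion_level[OF assms] unfolding is_expansion_def by blast+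

text \<open>
  Coordinate $0$ of \<open>x\<close> is the letter number \<open>offset x n\<close> of its block of level \<open>n\<close>, and the next such block
  starts at coordinate \<open>rest x n\<close>.
\<close>

definition offset :: "'a config \<Rightarrow> nat \<Rightarrow> nat" where
  "offset x n = (\<Sum>i<n. addr x i * p ^ i)"

definition rest :: "'a config \<Rightarrow> nat \<Rightarrow> nat" where
  "rest x n = p ^ n - offset x n"

lemma offset_0 [simp]: "offset x 0 = 0"
  by (simp add: offset_def)

lemma offset_Suc: "offset x (Suc n) = offset x n + addr x n * p ^ n"
  by (simp add: offset_def)

lemma offset_less:
  assumes "x \<in> X"
  shows "offset x n < p ^ n"
proof (induction n)
  case (Suc n)
  have "offset x (Suc n) < Suc (addr x n) * p ^ n" using Suc by (simp add: offset_Suc)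
  also have "\<dots> \<le> p * p ^ n" using address_less[OF assms, of n] by (intro mult_le_mono) auto
  finally show ?case by simp
qed simp

lemma int_rest: "x \<in> X \<Longrightarrow> int (rest x n) = int p ^ n - int (offset x n)"
  using offset_less[of x n] by (simp add: rest_def of_nat_diff)

lemma rest_0 [simp]: "rest x 0 = 1"
  by (simp add: rest_def)

lemma rest_Suc:
  assumes "x \<in> X"
  shows "rest x (Suc n) = rest x n + p ^ n * (p - 1 - addr x n)"
proof -
  have diff: "int (p - 1 - addr x n) = int p - 1 - int (addr x n)"
    using address_less[OF assms, of n] by (simp add: of_nat_diff)
  have "int (rest x (Suc n)) = int (rest x n + p ^ n * (p - 1 - addr x n))"
    unfolding of_nat_add of_nat_mult diff int_rest[OF assms] offset_Suc
    by (simp add: algebra_simps)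
  then show ?thesis by (simp only: of_nat_eq_iff)
qed

lemma rest_mono: "x \<in> X \<Longrightarrow> m \<le> n \<Longrightarrow> rest x m \<le> rest x n"
  by (rule lift_Suc_mono_le[of "rest x"]) (simp_all add: rest_Suc)

lemma level_funpow:
  assumes "x \<in> X"
  shows "x = shift (int (offset x n)) ((S ^^ n) (lev x n))"
proof (induction n)
  case (Suc n)
  have "(S ^^ n) (lev x n) = (S ^^ n) (shift (int (addr x n)) (S (lev x (Suc n))))"
    using level_step[OF assms, of n] by simp
  also have "\<dots> = shift (int p ^ n * int (addr x n)) ((S ^^ Suc n) (lev x (Suc n)))"
    by (simp add: funpow_S_shift funpow_swap1)
  finally have "shift (int (offset x n)) ((S ^^ n) (lev x n)) =
      shift (int (offset x (Suc n))) ((S ^^ Suc n) (lev x (Suc n)))"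
    by (simp add: offset_Suc algebra_simps del: funpow.simps)
  with Suc.IH show ?case by (rule trans)
qed (simp add: level_0[OF assms])

lemma coordinate_in_block:
  assumes "x \<in> X" "r < p ^ n"
  shows "x (int p ^ n * t + int r - int (offset x n)) = letter n (lev x n t) r"
proof -
  have "x i = (S ^^ n) (lev x n) (i + int (offset x n))" for i
    using fun_cong[OF level_funpow[OF assms(1), of n], of i] by (simp only: shift_apply)
  then have "x (int p ^ n * t + int r - int (offset x n)) = (S ^^ n) (lev x n) (int p ^ n * t + int r)"
    by simp
  also have "\<dots> = letter n (lev x n t) r" using assms(2) by (rule funpow_S_block)
  finally show ?thesis .
qed

text \<open>
  Shifting by \<open>k\<close> adds \<open>k\<close> to the $p$-adic integer with digits $\delta_i$. The carry into digit \<open>n\<close> counts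
  the blocks of level \<open>n\<close> by which coordinate $0$ moves; it is negative for some negative \<open>k\<close>.
\<close>

definition carry :: "'a config \<Rightarrow> int \<Rightarrow> nat \<Rightarrow> int" where
  "carry x k n = (int (offset x n) + k) div int p ^ n"

lemma carry_Suc: "carry x k (Suc n) = (int (addr x n) + carry x k n) div int p"
proof -
  have "int (offset x (Suc n)) + k = (int (offset x n) + k) + int (addr x n) * int p ^ n"
    by (simp add: offset_Suc)
  moreover have "z div int p ^ Suc n = z div int p ^ n div int p" for z
    by (simp add: zdiv_zmult2_eq mult.commute[of "int p"])
  ultimately have "carry x k (Suc n) =
      ((int (offset x n) + k) + int (addr x n) * int p ^ n) div int p ^ n div int p"
    unfolding carry_def by (simp only:)
  also have "((int (offset x n) + k) + int (addr x n) * int p ^ n) div int p ^ n =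
      int (addr x n) + (int (offset x n) + k) div int p ^ n"
    by (rule div_mult_self1) simp
  finally show ?thesis unfolding carry_def .
qed

lemma is_expansion_shift:
  assumes "x \<in> X"
  shows "is_expansion p \<tau> (shift k x) (\<lambda>n. shift (carry x k n) (lev x n))
    (\<lambda>n. nat ((int (addr x n) + carry x k n) mod int p))"
  unfolding is_expansion_def
proof (intro conjI allI)
  show "shift (carry x k 0) (lev x 0) = shift k x"
    by (simp add: carry_def level_0[OF assms])
  fix n
  show "shift (carry x k n) (lev x n) \<in> X" using level_in_X[OF assms] by simp
  show "nat ((int (addr x n) + carry x k n) mod int p) < p" by (simp add: nat_less_iff)
  have "shift (carry x k n) (lev x n) = shift (carry x k n) (shift (int (addr x n)) (S (lev x (Suc n))))"
    using level_step[OF assms, of n] by simp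
  also have "\<dots> = shift (int (addr x n) + carry x k n) (S (lev x (Suc n)))"
    by (simp add: add.commute)
  also have "int (addr x n) + carry x k n =
      (int (addr x n) + carry x k n) mod int p + int p * carry x k (Suc n)"
    by (simp add: carry_Suc)
  also have "shift \<dots> (S (lev x (Suc n))) =
      shift ((int (addr x n) + carry x k n) mod int p) (S (shift (carry x k (Suc n)) (lev x (Suc n))))"
    by (simp add: S_shift)
  also have "(int (addr x n) + carry x k n) mod int p =
      int (nat ((int (addr x n) + carry x k n) mod int p))"
    by simp
  finally show "shift (carry x k n) (lev x n) =
      shift (int (nat ((int (addr x n) + carry x k n) mod int p)))
        (S (shift (carry x k (Suc n)) (lev x (Suc n))))" .
qed

lemma address_shift:
  assumes "x \<in> X"
  shows "addr (shift k x) n = nat ((int (addr x n) + carry x k n) mod int p)"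
  using expansion_eqI(2)[OF is_expansion_shift[OF assms]] by simp

lemma address_shift_cong:
  assumes "x \<in> X" "y \<in> X" "addr x = addr y"
  shows "addr (shift k x) = addr (shift k y)"
proof
  fix n
  have "carry x k n = carry y k n" by (simp add: carry_def offset_def assms(3))
  then show "addr (shift k x) n = addr (shift k y) n"
    by (simp add: address_shift assms)
qed

lemma I_plus_iff:
  assumes "x \<in> X"
  shows "i \<in> I_plus p \<tau> x \<longleftrightarrow> addr x i \<noteq> p - 1"
  using address_less[OF assms, of i] by (auto simp: I_plus_def suffix_word_def)

lemma infinite_I_plusI:
  assumes "x \<in> X" "\<And>n. n \<ge> N \<Longrightarrow> addr x n = 0"
  shows "infinite (I_plus p \<tau> x)"
proof -
  have "{N..} \<subseteq> I_plus p \<tau> x" using assms p_ge2 by (auto simp: I_plus_iff)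
  then show ?thesis using infinite_Ici infinite_super by blast
qed

text \<open>
  Every digit other than $p-1$ at place $i$ makes \<^const>\<open>rest\<close> grow by at least $p^i$.
\<close>

lemma rest_unbounded:
  assumes "x \<in> X" "infinite (I_plus p \<tau> x)"
  obtains N where "\<And>n. n \<ge> N \<Longrightarrow> B < rest x n"
proof -
  obtain i where i: "i \<ge> B" "i \<in> I_plus p \<tau> x"
    using assms(2) unfolding infinite_nat_iff_unbounded_le by blast
  then have "addr x i < p - 1"
    using I_plus_iff[OF assms(1)] address_less[OF assms(1), of i] by force
  then have "p ^ i * 1 \<le> p ^ i * (p - 1 - addr x i)" by (intro mult_le_mono) auto
  then have "B < rest x (Suc i)"
    using i(1) less_p_power[of i] unfolding rest_Suc[OF assms(1)] by linarith
  then have "B < rest x n" if "n \<ge> Suc i" for n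
    using rest_mono[OF assms(1) that] by simp
  with that show ?thesis by blast
qed

text \<open>
  The letters of the suffix word at level \<open>n\<close> name the blocks of level \<open>n\<close> after the one around coordinate $0$,
  up to the end of the block of level $n+1$. These are the coordinates from \<open>rest x n\<close> to
  \<open>rest x (Suc n) - 1\<close>, and blocks determine their names.
\<close>

lemma suffix_word_eq_iff:
  assumes x: "x \<in> X" and y: "y \<in> X" and addr: "addr x = addr y"
  shows "suffix_word p \<tau> n x = suffix_word p \<tau> n y \<longleftrightarrow>
    (\<forall>j. int (rest x n) \<le> j \<and> j < int (rest x (Suc n)) \<longrightarrow> x j = y j)"
proof -
  have off: "offset y n = offset x n" by (simp add: offset_def addr)
  have restS: "int (rest x (Suc n)) = int p ^ n * (int p - int (addr x n)) - int (offset x n)"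
    by (simp add: int_rest[OF x] offset_Suc algebra_simps)
  have P: "int p ^ n > 0" by simp
  have "suffix_word p \<tau> n x = suffix_word p \<tau> n y \<longleftrightarrow>
      (\<forall>t\<in>{1..int p - 1 - int (addr x n)}. lev x n t = lev y n t)"
    by (simp add: suffix_word_def addr)
  also have "\<dots> \<longleftrightarrow> (\<forall>j. int (rest x n) \<le> j \<and> j < int (rest x (Suc n)) \<longrightarrow> x j = y j)"
  proof (intro iffI allI impI ballI)
    fix j
    assume eq: "\<forall>t\<in>{1..int p - 1 - int (addr x n)}. lev x n t = lev y n t"
      and j: "int (rest x n) \<le> j \<and> j < int (rest x (Suc n))"
    define t where "t = (j + int (offset x n)) div int p ^ n"
    define r where "r = nat ((j + int (offset x n)) mod int p ^ n)"
    have r: "int r = (j + int (offset x n)) mod int p ^ n" by (simp add: r_def)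
    then have "int r < int p ^ n" by simp
    then have r_less: "r < p ^ n" by (simp flip: of_nat_power)
    have j_eq: "j = int p ^ n * t + int r - int (offset x n)" by (simp add: r t_def)
    have "int p ^ n * 1 \<le> j + int (offset x n)" using j by (simp add: int_rest[OF x])
    then have "1 \<le> t" unfolding t_def using P by (metis mult.commute zdiv_mono1 nonzero_mult_div_cancel_right less_irrefl)
    moreover have "int p ^ n * t < int p ^ n * (int p - int (addr x n))"
      using j j_eq restS by linarith
    then have "t < int p - int (addr x n)" using P by (simp only: mult_less_cancel_left_pos)
    ultimately have "lev x n t = lev y n t" using eq by simp
    then show "x j = y j"
      using coordinate_in_block[OF x r_less, of t] coordinate_in_block[OF y r_less, of t]
      by (simp add: j_eq off)
  next
    fix t
    assume eq: "\<forall>j. int (rest x n) \<le> j \<and> j < int (rest x (Suc n)) \<longrightarrow> x j = y j"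
      and t: "t \<in> {1..int p - 1 - int (addr x n)}"
    show "lev x n t = lev y n t"
    proof (rule letter_inject)
      fix r assume r: "r < p ^ n"
      then have r': "int r < int p ^ n" by (simp flip: of_nat_power)
      define j where "j = int p ^ n * t + int r - int (offset x n)"
      have "int p ^ n * 1 \<le> int p ^ n * t" using t P by (intro mult_left_mono) auto
      then have "int (rest x n) \<le> j" unfolding j_def int_rest[OF x] by linarith
      moreover have "int p ^ n * (t + 1) \<le> int p ^ n * (int p - int (addr x n))"
        using t P by (intro mult_left_mono) auto
      then have "j < int (rest x (Suc n))"
        using r' unfolding j_def restS distrib_left[of _ t] mult_1_right by linarith
      ultimately have "x j = y j" using eq by blast
      then show "letter n (lev x n t) r = letter n (lev y n t) r"
        using coordinate_in_block[OF x r, of t] coordinate_in_block[OF y r, of t]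
        by (simp add: j_def off)
    qed
  qed
  finally show ?thesis .
qed

text \<open>
  The word whose length is taken in \<^const>\<open>k_plus\<close> covers the coordinates from $0$ to \<open>rest x (Suc i) - 1\<close>, and
  \<^const>\<open>rest\<close> no longer changes once all digits are $p-1$.
\<close>

lemma k_plus_eq_rest:
  assumes x: "x \<in> X" and fin: "finite (I_plus p \<tau> x)"
  obtains N where "\<And>n. n \<ge> N \<Longrightarrow> rest x n = the_enat (k_plus p \<tau> x)"
    "\<And>n. n \<ge> N \<Longrightarrow> addr x n = p - 1"
proof -
  have len: "length (x 0 # concat (map (\<lambda>j. (subst_word \<tau> ^^ j) (suffix_word p \<tau> j x)) [0..<m])) = rest x m" for m
  proof (induction m)
    case (Suc m)
    have "length (suffix_word p \<tau> m x) = p - 1 - addr x m"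
      by (simp add: suffix_word_def nat_diff_distrib' flip: of_nat_diff)
    with Suc show ?case
      by (simp add: rest_Suc[OF x] length_subst_word_funpow[OF const_len])
  qed simp
  define N where "N = (if I_plus p \<tau> x = {} then 0 else Suc (Max (I_plus p \<tau> x)))"
  have N: "addr x n = p - 1" if "n \<ge> N" for n
  proof -
    have "n \<notin> I_plus p \<tau> x"
      using that Max_ge[OF fin, of n] by (auto simp: N_def split: if_splits)
    then show ?thesis using I_plus_iff[OF x] by blast
  qed
  have "k_plus p \<tau> x = enat (rest x N)"
  proof (cases "I_plus p \<tau> x = {}")
    case True
    then show ?thesis by (simp add: k_plus_def N_def one_enat_def)
  next
    case False
    have "(SUP i\<in>I_plus p \<tau> x. enat (rest x (Suc i))) = enat (rest x N)"
    proof (rule antisym)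
      have "rest x (Suc i) \<le> rest x N" if "i \<in> I_plus p \<tau> x" for i
        using rest_mono[OF x] Max_ge[OF fin that] False by (simp add: N_def)
      then show "(SUP i\<in>I_plus p \<tau> x. enat (rest x (Suc i))) \<le> enat (rest x N)"
        by (intro SUP_least) simp
      show "enat (rest x N) \<le> (SUP i\<in>I_plus p \<tau> x. enat (rest x (Suc i)))"
        using False by (simp add: N_def) (rule SUP_upper[OF Max_in[OF fin False]])
    qed
    then show ?thesis using False unfolding k_plus_def len by simp
  qed
  then have k: "the_enat (k_plus p \<tau> x) = rest x N" by simp
  have "rest x n = rest x N" if "n \<ge> N" for n
    using that
  proof (induction n rule: dec_induct)
    case (step n)
    then show ?case using N[of n] by (simp add: rest_Suc[OF x])
  qed simp
  then have "rest x n = the_enat (k_plus p \<tau> x)" if "n \<ge> N" for n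
    unfolding k using that by blast
  from that[OF this N] show ?thesis .
qed

text \<open>
  At coordinate \<open>k_plus\<close> begins a block of every large level, with \<open>offset\<close> equal to $0$. From there on
  coordinate \<open>i\<close> has a bounded offset, and all its large digits vanish.
\<close>

lemma address_eventually_0:
  assumes x: "x \<in> X" and fin: "finite (I_plus p \<tau> x)" and i: "i \<ge> int (the_enat (k_plus p \<tau> x))"
  obtains N where "\<And>n. n \<ge> N \<Longrightarrow> addr (shift i x) n = 0"
proof -
  let ?k = "the_enat (k_plus p \<tau> x)"
  obtain N where N: "\<And>n. n \<ge> N \<Longrightarrow> rest x n = ?k" "\<And>n. n \<ge> N \<Longrightarrow> addr x n = p - 1"
    using k_plus_eq_rest[OF x fin] by blast
  define l where "l = nat (i - int ?k)"
  have l: "i = int ?k + int l" using i by (simp add: l_def)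
  have "addr (shift i x) n = 0" if n: "n \<ge> max N l" for n
  proof -
    have "l < p ^ n" using less_p_power[of n] n by linarith
    then have "int l < int p ^ n" by (simp flip: of_nat_power)
    moreover have "int (offset x n) + i = int l + int p ^ n * 1"
      using int_rest[OF x, of n] N(1)[of n] n l by simp
    \<comment> \<open>So the addition of $i$ turns all digits $p-1$ from place $N$ on into $0$.\<close>
    ultimately have "carry x i n = 1"
      unfolding carry_def by (simp add: div_add_self2)
    moreover have "int (addr x n) = int p - 1" using N(2)[of n] n p_ge2 by (simp add: of_nat_diff)
    ultimately show ?thesis by (simp add: address_shift[OF x])
  qed
  with that show ?thesis by blast
qed

text \<open>
  If \<open>I_plus\<close> is finite, coordinates from \<open>k_plus\<close> on have large digits $0$. If it is infinite,
  moving to the right by a fixed amount changes only finitely many digits.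
\<close>

lemma infinite_I_plus_shift:
  assumes x: "x \<in> X"
  obtains M where "\<And>i. i \<ge> M \<Longrightarrow> infinite (I_plus p \<tau> (shift i x))"
proof (cases "finite (I_plus p \<tau> x)")
  case True
  have "infinite (I_plus p \<tau> (shift i x))" if i: "i \<ge> int (the_enat (k_plus p \<tau> x))" for i
  proof -
    obtain N where "\<And>n. n \<ge> N \<Longrightarrow> addr (shift i x) n = 0"
      using address_eventually_0[OF x True i] by blast
    then show ?thesis using x by (intro infinite_I_plusI) auto
  qed
  with that show ?thesis by blast
next
  case False
  have "infinite (I_plus p \<tau> (shift i x))" if "i \<ge> 0" for i
  proof -
    obtain N where N: "\<And>n. n \<ge> N \<Longrightarrow> nat i < rest x n"
      using rest_unbounded[OF x False] by blast
    have same: "addr (shift i x) n = addr x n" if "n \<ge> N" for n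
    proof -
      have "int (offset x n) + i < int p ^ n"
        using N[OF that] \<open>i \<ge> 0\<close> int_rest[OF x, of n] by linarith
      then have "carry x i n = 0" unfolding carry_def using \<open>i \<ge> 0\<close> by simp
      then show ?thesis using address_less[OF x, of n] by (simp add: address_shift[OF x])
    qed
    have "I_plus p \<tau> x - {..<N} \<subseteq> I_plus p \<tau> (shift i x)"
    proof
      fix n assume "n \<in> I_plus p \<tau> x - {..<N}"
      then show "n \<in> I_plus p \<tau> (shift i x)"
        using x same[of n] by (simp add: I_plus_iff)
    qed
    then show ?thesis using False by (meson Diff_infinite_finite finite_lessThan finite_subset)
  qed
  with that show ?thesis by blast
qed

section \<open>Asymptotic, distal and Li--Yorke pairs\<close>

text \<open>
  The stretches between consecutive values of \<^const>\<open>rest\<close> cover a half-line when \<^const>\<open>rest\<close> is unbounded.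
\<close>

lemma eventually_equal_iff_suffixes:
  assumes x: "x \<in> X" and y: "y \<in> X" and addr: "addr x = addr y" and inf: "infinite (I_plus p \<tau> x)"
  shows "(\<exists>M. \<forall>j\<ge>M. x j = y j) \<longleftrightarrow>
    (\<forall>\<^sub>F i in sequentially. suffix_word p \<tau> i x = suffix_word p \<tau> i y)"
proof
  assume "\<exists>M. \<forall>j\<ge>M. x j = y j"
  then obtain M where M: "\<And>j. j \<ge> M \<Longrightarrow> x j = y j" by blast
  obtain N where N: "\<And>n. n \<ge> N \<Longrightarrow> nat M < rest x n" using rest_unbounded[OF x inf] by blast
  have "suffix_word p \<tau> n x = suffix_word p \<tau> n y" if "n \<ge> N" for n
    unfolding suffix_word_eq_iff[OF x y addr]
  proof (intro allI impI M)
    fix j assume "int (rest x n) \<le> j \<and> j < int (rest x (Suc n))"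
    then show "M \<le> j" using N[OF that] by linarith
  qed
  then show "\<forall>\<^sub>F i in sequentially. suffix_word p \<tau> i x = suffix_word p \<tau> i y"
    unfolding eventually_sequentially by blast
next
  assume "\<forall>\<^sub>F i in sequentially. suffix_word p \<tau> i x = suffix_word p \<tau> i y"
  then obtain N where N: "\<And>n. n \<ge> N \<Longrightarrow> suffix_word p \<tau> n x = suffix_word p \<tau> n y"
    unfolding eventually_sequentially by blast
  have below: "x j = y j" if "n \<ge> N" "int (rest x N) \<le> j" "j < int (rest x n)" for n j
    using that
  proof (induction n rule: dec_induct)
    case (step n)
    show ?case
    proof (cases "j < int (rest x n)")
      case False
      then show ?thesis
        using N[OF step.hyps(1)] step.prems unfolding suffix_word_eq_iff[OF x y addr] by simp
    qed (use step in simp)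
  qed simp
  have "x j = y j" if "j \<ge> int (rest x N)" for j
  proof -
    obtain K where "\<And>n. n \<ge> K \<Longrightarrow> nat j < rest x n" using rest_unbounded[OF x inf] by blast
    then have "nat j < rest x (max K N)" by simp
    then show ?thesis using that by (intro below[of "max K N"]) linarith+
  qed
  then show "\<exists>M. \<forall>j\<ge>M. x j = y j" by blast
qed

lemma eventually_equal_shift_iff:
  fixes x y :: "'a config"
  shows "(\<exists>M. \<forall>j\<ge>M. shift k x j = shift k y j) \<longleftrightarrow> (\<exists>M. \<forall>j\<ge>M. x j = y j)"
proof
  assume "\<exists>M. \<forall>j\<ge>M. shift k x j = shift k y j"
  then obtain M where M: "\<And>j. j \<ge> M \<Longrightarrow> x (j + k) = y (j + k)" by auto
  have "x j = y j" if "j \<ge> M + k" for j using M[of "j - k"] that by simp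
  then show "\<exists>M. \<forall>j\<ge>M. x j = y j" by blast
next
  assume "\<exists>M. \<forall>j\<ge>M. x j = y j"
  then obtain M where M: "\<And>j. j \<ge> M \<Longrightarrow> x j = y j" by blast
  have "shift k x j = shift k y j" if "j \<ge> M - k" for j using M[of "j + k"] that by simp
  then show "\<exists>M. \<forall>j\<ge>M. shift k x j = shift k y j" by blast
qed

text \<open>
  A difference at coordinate $0$ is inherited by the names of the surrounding blocks of all levels, and
  these blocks in turn differ at every place.
\<close>

lemma always_different:
  assumes x: "x \<in> X" and y: "y \<in> X" and addr: "addr x = addr y" and inf: "infinite (I_plus p \<tau> x)"
    and nc: "\<not> has_coincidence \<tau>" and neq: "x 0 \<noteq> y 0" and j: "j \<ge> 0"
  shows "x j \<noteq> y j"
proof -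
  obtain n where n: "nat j < rest x n" using rest_unbounded[OF x inf] by blast
  have off: "offset y n = offset x n" by (simp add: offset_def addr)
  have block: "z j = letter n (lev z n 0) (nat (j + int (offset x n)))"
    if "z \<in> X" "offset z n = offset x n" "0 \<le> j" "j < int (rest x n)" for z j
  proof -
    have "j + int (offset x n) < int p ^ n" using that(4) by (simp add: int_rest[OF x])
    then have "nat (j + int (offset x n)) < p ^ n" using that(3) by (simp add: nat_less_iff)
    from coordinate_in_block[OF that(1) this, of 0] show ?thesis using that(2,3) by simp
  qed
  have "lev x n 0 \<noteq> lev y n 0"
  proof
    assume eq: "lev x n 0 = lev y n 0"
    have "0 < int (rest x n)" using n by linarith
    from block[OF x refl _ this] block[OF y off _ this] eq neq show False by simp
  qed
  then show ?thesis
    using block[OF x refl j] block[OF y off j] n letter_neq[OF nc] by simp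
qed

text \<open>
  Let \<open>n\<close> be the first place where the digits differ. A shift produces the same carry into place
  \<open>n\<close> in both points, so the digits at place \<open>n\<close> remain different, while agreement on a sufficiently large
  window would force them to be equal.
\<close>

lemma never_agree_if_addresses_differ:
  assumes x: "x \<in> X" and y: "y \<in> X" and neq: "addr x \<noteq> addr y"
  obtains M where "\<And>k. \<not> agree M (shift k x) (shift k y)"
proof -
  \<comment> \<open>Each level depends uniformly continuously on the point, one desubstitution at a time.\<close>
  have loc: "\<exists>M. \<forall>x\<in>X. \<forall>y\<in>X. agree M x y \<longrightarrow> agree M' (lev x n) (lev y n)" for n M'
  proof (induction n arbitrary: M')
    case 0
    then show ?case using level_0 by (metis (no_types))
  next
    case (Suc n)
    obtain M1 where M1: "\<And>x y u v a b. \<lbrakk>x \<in> X; y \<in> X; u \<in> X; v \<in> X; a < p; b < p; x = shift (int a) (S u);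
       y = shift (int b) (S v); agree M1 x y\<rbrakk> \<Longrightarrow> a = b \<and> agree M' u v"
      using uniform_recognizability by blast
    obtain M where M: "\<And>x y. \<lbrakk>x \<in> X; y \<in> X; agree M x y\<rbrakk> \<Longrightarrow> agree M1 (lev x n) (lev y n)"
      using Suc.IH by blast
    have "agree M' (lev x (Suc n)) (lev y (Suc n))" if "x \<in> X" "y \<in> X" "agree M x y" for x y
      using M1[OF level_in_X[OF that(1)] level_in_X[OF that(2)] level_in_X[OF that(1)]
          level_in_X[OF that(2)] address_less[OF that(1)] address_less[OF that(2)]
          level_step[OF that(1)] level_step[OF that(2)] M[OF that]] by (rule conjunct2)
    then show ?case by blast
  qed
  have "\<exists>n. addr x n \<noteq> addr y n" using neq by (simp add: fun_eq_iff)
  then obtain n where n: "addr x n \<noteq> addr y n" "\<And>i. i < n \<Longrightarrow> addr x i = addr y i"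
    using exists_least_iff[of "\<lambda>n. addr x n \<noteq> addr y n"] by auto
  obtain M1 where M1: "\<And>x y u v a b. \<lbrakk>x \<in> X; y \<in> X; u \<in> X; v \<in> X; a < p; b < p; x = shift (int a) (S u);
       y = shift (int b) (S v); agree M1 x y\<rbrakk> \<Longrightarrow> a = b \<and> agree 0 u v"
    using uniform_recognizability by blast
  obtain M where M: "\<And>x y. \<lbrakk>x \<in> X; y \<in> X; agree M x y\<rbrakk> \<Longrightarrow> agree M1 (lev x n) (lev y n)"
    using loc by blast
  have "\<not> agree M (shift k x) (shift k y)" for k
  proof
    assume agr: "agree M (shift k x) (shift k y)"
    have mem: "shift k x \<in> X" "shift k y \<in> X" using x y by simp_all
    have eq: "addr (shift k x) n = addr (shift k y) n"
      using M1[OF level_in_X[OF mem(1)] level_in_X[OF mem(2)] level_in_X[OF mem(1)]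
          level_in_X[OF mem(2)] address_less[OF mem(1)] address_less[OF mem(2)]
          level_step[OF mem(1)] level_step[OF mem(2)] M[OF mem agr]] by (rule conjunct1)
    have "offset x n = offset y n" unfolding offset_def using n(2) by (intro sum.cong) auto
    then have carry: "carry y k n = carry x k n" by (simp add: carry_def)
    have "(int (addr x n) + carry x k n) mod int p = (int (addr y n) + carry x k n) mod int p"
      using eq unfolding address_shift[OF x] address_shift[OF y] carry
      by (simp add: nat_eq_iff)
    then have "int (addr x n) mod int p = int (addr y n) mod int p"
      by (metis add_diff_cancel_right' mod_diff_left_eq)
    then show False using n(1) address_less[OF x, of n] address_less[OF y, of n] by simp
  qed
  with that show ?thesis by blast
qed

lemma distal_if_never_coincide:
  assumes "compatible_metric X \<rho>" and "x \<in> X" "y \<in> X" and "\<And>j. j \<ge> N \<Longrightarrow> x j \<noteq> y j"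
  shows "distal_pair \<rho> x y"
proof (rule distal_if_never_agree[OF subshift_X assms(1-3)])
  fix n assume "n \<ge> nat N"
  then have "x (int n) \<noteq> y (int n)" by (intro assms(4)) simp
  then show "\<not> agree 0 (shift (int n) x) (shift (int n) y)" by (simp add: agree_def)
qed

lemma asymptotic_pairs_iff:
  assumes "compatible_metric X \<rho>" "x \<in> X" "y \<in> X"
  shows "(x, y) \<in> asymptotic_pairs X \<rho> \<longleftrightarrow> (\<exists>M. \<forall>j\<ge>M. x j = y j)"
  using asymptotic_iff_eventually_equal[OF subshift_X assms] assms(2,3)
  by (simp add: asymptotic_pairs_def)

text \<open>
  If \<open>I_plus\<close> is finite, both points are shifted by \<open>k_plus\<close>, after which the infinite case applies.
\<close>

theorem asymptotic_iff_suffixes: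
  assumes \<rho>: "compatible_metric X \<rho>" and x: "x \<in> X" and y: "y \<in> X" and addr: "addr x = addr y"
  defines "k \<equiv> int (the_enat (k_plus p \<tau> x))"
  shows "(x, y) \<in> asymptotic_pairs X \<rho> \<longleftrightarrow>
    (infinite (I_plus p \<tau> x) \<and> (\<forall>\<^sub>F i in sequentially. suffix_word p \<tau> i x = suffix_word p \<tau> i y)) \<or>
    (finite (I_plus p \<tau> x) \<and>
      (\<forall>\<^sub>F i in sequentially. suffix_word p \<tau> i (shift k x) = suffix_word p \<tau> i (shift k y)))"
proof (cases "finite (I_plus p \<tau> x)")
  case False
  then show ?thesis
    by (simp add: asymptotic_pairs_iff[OF \<rho> x y] eventually_equal_iff_suffixes[OF x y addr False])
next
  case True
  obtain N where "\<And>n. n \<ge> N \<Longrightarrow> addr (shift k x) n = 0"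
    using address_eventually_0[OF x True] unfolding k_def by blast
  then have inf: "infinite (I_plus p \<tau> (shift k x))" using x by (intro infinite_I_plusI) auto
  have mem: "shift k x \<in> X" "shift k y \<in> X" using x y by simp_all
  have "(\<exists>M. \<forall>j\<ge>M. shift k x j = shift k y j) \<longleftrightarrow>
      (\<forall>\<^sub>F i in sequentially. suffix_word p \<tau> i (shift k x) = suffix_word p \<tau> i (shift k y))"
    by (rule eventually_equal_iff_suffixes[OF mem address_shift_cong[OF x y addr] inf])
  then show ?thesis
    using True unfolding asymptotic_pairs_iff[OF \<rho> x y] eventually_equal_shift_iff by blast
qed

lemma distal_without_coincidence:
  assumes \<rho>: "compatible_metric X \<rho>" and x: "x \<in> X" and y: "y \<in> X" and addr: "addr x = addr y"
    and nc: "\<not> has_coincidence \<tau>" and i: "x i \<noteq> y i" "infinite (I_plus p \<tau> (shift i x))"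
  shows "distal_pair \<rho> x y"
proof (rule distal_if_never_coincide[OF \<rho> x y])
  have mem: "shift i x \<in> X" "shift i y \<in> X" using x y by simp_all
  have neq: "shift i x 0 \<noteq> shift i y 0" using i(1) by simp
  fix j assume "j \<ge> i"
  then have "j - i \<ge> 0" by simp
  then have "shift i x (j - i) \<noteq> shift i y (j - i)"
    by (rule always_different[OF mem address_shift_cong[OF x y addr] i(2) nc neq])
  then show "x j \<noteq> y j" by simp
qed

lemma asymptotic_otherwise:
  assumes \<rho>: "compatible_metric X \<rho>" and x: "x \<in> X" and y: "y \<in> X"
    and none: "\<not> (\<exists>i. x i \<noteq> y i \<and> infinite (I_plus p \<tau> (shift i x)))"
  shows "(x, y) \<in> asymptotic_pairs X \<rho>"
proof -
  obtain M where "\<And>i. i \<ge> M \<Longrightarrow> infinite (I_plus p \<tau> (shift i x))"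
    using infinite_I_plus_shift[OF x] by blast
  then show ?thesis using none unfolding asymptotic_pairs_iff[OF \<rho> x y] by blast
qed

lemma no_li_yorke_pairs:
  assumes \<rho>: "compatible_metric X \<rho>" and nc: "\<not> has_coincidence \<tau>"
  shows "li_yorke_pairs X \<rho> = {}"
proof -
  have "distal_pair \<rho> x y \<or> asymptotic_pair \<rho> x y" if xy: "x \<in> X" "y \<in> X" for x y
  proof (cases "addr x = addr y")
    case True
    then show ?thesis
      using distal_without_coincidence[OF \<rho> xy True nc] asymptotic_otherwise[OF \<rho> xy]
      unfolding asymptotic_pairs_def by blast
  next
    case False
    obtain M where M: "\<And>k. \<not> agree M (shift k x) (shift k y)"
      using never_agree_if_addresses_differ[OF xy False] by blast
    have "distal_pair \<rho> x y"
      using distal_if_never_agree[OF subshift_X \<rho> xy, of 0 M] M by blast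
    then show ?thesis ..
  qed
  then show ?thesis
    unfolding li_yorke_pairs_def proximal_pair_def distal_pair_def by force
qed

end

theorem proposition3p4:
  fixes \<tau> :: "'a::finite \<Rightarrow> 'a list" and p :: nat
    and \<rho> :: "'a config \<Rightarrow> 'a config \<Rightarrow> real"
    and x y :: "'a config" and I :: "nat set" and k :: enat
  assumes "substitution \<tau>" and "inj \<tau>" and "primitive \<tau>"
    and "constant_length p \<tau>" and "p \<ge> 2"
    and "infinite (subst_shift \<tau>)"
    and "compatible_metric (subst_shift \<tau>) \<rho>"
    and "x \<in> subst_shift \<tau>" and "y \<in> subst_shift \<tau>"
    and "address p \<tau> x = address p \<tau> y"
    and "I = I_plus p \<tau> x" and "k = k_plus p \<tau> x"
  shows
    "((x, y) \<in> asymptotic_pairs (subst_shift \<tau>) \<rho> \<longleftrightarrow>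
        (infinite I \<and> (\<forall>\<^sub>F i in sequentially. suffix_word p \<tau> i x = suffix_word p \<tau> i y)) \<or>
        (finite I \<and>
          (\<forall>\<^sub>F i in sequentially.
             suffix_word p \<tau> i (shift (int (the_enat k)) x) =
             suffix_word p \<tau> i (shift (int (the_enat k)) y)))) \<and>
     (\<not> has_coincidence \<tau> \<longrightarrow>
        ((\<exists>i. x i \<noteq> y i \<and> infinite (I_plus p \<tau> (shift i x))) \<longrightarrow> distal_pair \<rho> x y) \<and>
        (\<not> (\<exists>i. x i \<noteq> y i \<and> infinite (I_plus p \<tau> (shift i x))) \<longrightarrow>
           (x, y) \<in> asymptotic_pairs (subst_shift \<tau>) \<rho>) \<and>
        li_yorke_pairs (subst_shift \<tau>) \<rho> = {})"
proof -
  interpret aperiodic_substitution \<tau> p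
    using assms(2-6) by unfold_locales
  note pair = assms(7-10)
  show ?thesis
    unfolding assms(11,12)
    using asymptotic_iff_suffixes[OF pair] distal_without_coincidence[OF pair]
      asymptotic_otherwise[OF pair(1-3)] no_li_yorke_pairs[OF pair(1)]
    by blast
qed

end
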